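(* Let $\mathcal{P}\subseteq2^\omega$ be a nonempty $\Pi^0_1$ class. Then $X\in\mathcal{P}$ is a randomly produced path through $T_{\mathcal{P}}$ if and only if there is a constant $c$ such that for all $n$, $$K^{T_{\mathcal{P}}}(X\upharpoonright n)\ge\theta_{\mathcal{P}}(X\upharpoonright n)-c.$$
   Context: Notation: $2^\omega$ is the set of infinite binary sequences, $2^{<\omega}$ the set of finite binary strings, $|\sigma|$ the length of $\sigma$, $X\upharpoonright n$ (or $\sigma\upharpoonright n$) the initial segment of length $n$, $[\![\sigma]\!]=\{X\in2^\omega:\sigma\prec X\}$. For nonempty $\sigma$, $\sigma^{\curvearrowright}$ is the string obtained by flipping the last bit of $\sigma$. A $\Pi^0_1$ class is the set of infinite paths through a computable tree $T\subseteq2^{<\omega}$. For a closed set $\mathcal{P}$, $T_{\mathcal{P}}=\{\sigma:\mathcal{P}\cap[\![\sigma]\!]\neq\emptyset\}$. $K^A$ is prefix-free Kolmogorov complexity relative to the oracle $A$. $\mathsf{MLR}^A$ is the set of sequences that are Martin-Löf random relative to $A$ with respect to Lebesgue measure. $\theta_{\mathcal{P}}(\sigma)=\#\{n:1\le n\le|\sigma|\ \&\ (\sigma\upharpoonright n)^{\curvearrowright}\in T_{\mathcal{P}}\}$. Randomly produced paths: for $R\in2^\omega$, $\Psi_{\mathcal{P}}(R)\in\mathcal{P}$ is the sequence $X$ built recursively as follows. Given $\sigma=X\upharpoonright m\in T_{\mathcal{P}}$, let $n$ be the number of bits of $R$ used so far, i.e. the number of $j<m$ such that both one-bit extensions of $X\upharpoonright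 j$ lie in $T_{\mathcal{P}}$. If only one $i\in\{0,1\}$ satisfies $\sigma i\in T_{\mathcal{P}}$, put $X(m)=i$; if both $\sigma0,\sigma1\in T_{\mathcal{P}}$, put $X(m)=R(n)$. The randomly produced paths through $T_{\mathcal{P}}$ are the members of $\{\Psi_{\mathcal{P}}(R):R\in\mathsf{MLR}^{T_{\mathcal{P}}}\}$. *)

theory Defs
  imports "HOL-Probability.Probability" "HOL-Library.Nat_Bijection" "HOL-Library.Sublist"
begin

section \<open>Computability relative to an oracle\<close>

definition minimize :: "(nat \<Rightarrow> nat option) \<Rightarrow> nat option" where
  "minimize h =
    (let zero = (\<lambda>n. h n = Some 0 \<and> (\<forall>m<n. \<exists>k. h m = Some (Suc k)))
     in if \<exists>n. zero n then Some (LEAST n. zero n) else None)"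

text \<open>Kleene's partial recursive functions relative to the characteristic function of \<open>A\<close>.
  Functions of several arguments are presented as unary functions, tuples being coded by the
  Cantor pairing function \<open>prod_encode\<close>; \<open>None\<close> stands for divergence.\<close>

inductive recursive_in :: "nat set \<Rightarrow> (nat \<Rightarrow> nat option) \<Rightarrow> bool" for A where
  zero: "recursive_in A (\<lambda>_. Some 0)"
| succ: "recursive_in A (\<lambda>x. Some (Suc x))"
| left: "recursive_in A (\<lambda>x. Some (fst (prod_decode x)))"
| right: "recursive_in A (\<lambda>x. Some (snd (prod_decode x)))"
| orac: "recursive_in A (\<lambda>x. Some (of_bool (x \<in> A)))"
| pair: "recursive_in A f \<Longrightarrow> recursive_in A g \<Longrightarrow>
    recursive_in A (\<lambda>x. Option.bind (f x) (\<lambda>y. Option.bind (g x) (\<lambda>z. Some (prod_encode (y, z)))))"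
| comp: "recursive_in A f \<Longrightarrow> recursive_in A g \<Longrightarrow>
    recursive_in A (\<lambda>x. Option.bind (g x) f)"
| prec: "recursive_in A f \<Longrightarrow> recursive_in A g \<Longrightarrow>
    recursive_in A (\<lambda>x. case prod_decode x of (a, n) \<Rightarrow>
      rec_nat (f a) (\<lambda>y r. Option.bind r (\<lambda>i. g (prod_encode (a, prod_encode (y, i))))) n)"
| mu: "recursive_in A f \<Longrightarrow>
    recursive_in A (\<lambda>a. minimize (\<lambda>n. f (prod_encode (a, n))))"

definition computable_set :: "nat set \<Rightarrow> bool" where
  "computable_set S \<longleftrightarrow> recursive_in {} (\<lambda>x. Some (of_bool (x \<in> S)))"

definition ce_in :: "nat set \<Rightarrow> nat set \<Rightarrow> bool" where
  "ce_in A S \<longleftrightarrow> (\<exists>f. recursive_in A f \<and> S = dom f)"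

section \<open>Strings, sequences and \<open>\<Pi>\<^sup>0\<^sub>1\<close> classes\<close>

text \<open>Numerical code of a finite binary string, through which notions of computability on
  \<open>nat\<close> are transferred to strings.\<close>

definition str_code :: "bool list \<Rightarrow> nat" where
  "str_code \<sigma> = list_encode (map of_bool \<sigma>)"

definition initseg :: "(nat \<Rightarrow> bool) \<Rightarrow> nat \<Rightarrow> bool list" (infixl "\<restriction>\<^bsub>seq\<^esub>" 90) where
  "X \<restriction>\<^bsub>seq\<^esub> n = map X [0..<n]"

definition cylinder :: "bool list \<Rightarrow> (nat \<Rightarrow> bool) set" where
  "cylinder \<sigma> = {X. X \<restriction>\<^bsub>seq\<^esub> length \<sigma> = \<sigma>}"

definition binary_tree :: "bool list set \<Rightarrow> bool" where
  "binary_tree T \<longleftrightarrow> (\<forall>\<sigma>\<in>T. \<forall>\<tau>. prefix \<tau> \<sigma> \<longrightarrow> \<tau> \<in> T)"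

definition infinite_paths :: "bool list set \<Rightarrow> (nat \<Rightarrow> bool) set" where
  "infinite_paths T = {X. \<forall>n. X \<restriction>\<^bsub>seq\<^esub> n \<in> T}"

definition Pi01_class :: "(nat \<Rightarrow> bool) set \<Rightarrow> bool" where
  "Pi01_class P \<longleftrightarrow>
    (\<exists>T. binary_tree T \<and> computable_set (str_code ` T) \<and> P = infinite_paths T)"

definition extendible :: "(nat \<Rightarrow> bool) set \<Rightarrow> bool list set" where
  "extendible P = {\<sigma>. P \<inter> cylinder \<sigma> \<noteq> {}}"

text \<open>The tree \<open>T\<^sub>P\<close> as an oracle.\<close>

definition tree_oracle :: "(nat \<Rightarrow> bool) set \<Rightarrow> nat set" where
  "tree_oracle P = str_code ` extendible P"

definition flip_last :: "bool list \<Rightarrow> bool list" where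
  "flip_last \<sigma> = butlast \<sigma> @ [\<not> last \<sigma>]"

definition theta :: "(nat \<Rightarrow> bool) set \<Rightarrow> bool list \<Rightarrow> nat" where
  "theta P \<sigma> = card {n. 1 \<le> n \<and> n \<le> length \<sigma> \<and> flip_last (take n \<sigma>) \<in> extendible P}"

section \<open>Martin-Loef randomness relative to an oracle\<close>

definition cantor_measure :: "(nat \<Rightarrow> bool) measure" where
  "cantor_measure = (\<Pi>\<^sub>M i\<in>(UNIV :: nat set). measure_pmf (bernoulli_pmf (1/2)))"

definition MartinLoef_test :: "nat set \<Rightarrow> (nat \<Rightarrow> bool list set) \<Rightarrow> bool" where
  "MartinLoef_test A V \<longleftrightarrow>
    ce_in A {prod_encode (n, str_code \<sigma>) | n \<sigma>. \<sigma> \<in> V n} \<and>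
    (\<forall>n. measure cantor_measure (\<Union>\<sigma>\<in>V n. cylinder \<sigma>) \<le> (1/2) ^ n)"

definition MLR :: "nat set \<Rightarrow> (nat \<Rightarrow> bool) set" where
  "MLR A = {X. \<forall>V. MartinLoef_test A V \<longrightarrow> X \<notin> (\<Inter>n. \<Union>\<sigma>\<in>V n. cylinder \<sigma>)}"

section \<open>Prefix-free Kolmogorov complexity relative to an oracle\<close>

definition prefix_free :: "bool list set \<Rightarrow> bool" where
  "prefix_free D \<longleftrightarrow> (\<forall>\<sigma>\<in>D. \<forall>\<tau>\<in>D. prefix \<sigma> \<tau> \<longrightarrow> \<sigma> = \<tau>)"

definition prefix_free_machine :: "nat set \<Rightarrow> (bool list \<Rightarrow> bool list option) \<Rightarrow> bool" where
  "prefix_free_machine A M \<longleftrightarrow>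
    (\<exists>f. recursive_in A f \<and> (\<forall>\<tau>. f (str_code \<tau>) = map_option str_code (M \<tau>))) \<and>
    prefix_free (dom M)"

definition optimal_machine :: "nat set \<Rightarrow> (bool list \<Rightarrow> bool list option) \<Rightarrow> bool" where
  "optimal_machine A U \<longleftrightarrow> prefix_free_machine A U \<and>
    (\<forall>M. prefix_free_machine A M \<longrightarrow>
      (\<exists>c. \<forall>\<tau> \<sigma>. M \<tau> = Some \<sigma> \<longrightarrow>
        (\<exists>\<rho>. U \<rho> = Some \<sigma> \<and> length \<rho> \<le> length \<tau> + c)))"

text \<open>The complexity \<open>K\<^sup>A\<close> is \<open>complexity U\<close> for a machine \<open>U\<close> that is optimal among the prefix-free
  machines with oracle \<open>A\<close>; such a \<open>U\<close> outputs every string, so the minimum exists.\<close>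

definition complexity :: "(bool list \<Rightarrow> bool list option) \<Rightarrow> bool list \<Rightarrow> nat" where
  "complexity U \<sigma> = (LEAST k. \<exists>\<tau>. U \<tau> = Some \<sigma> \<and> length \<tau> = k)"

section \<open>Randomly produced paths\<close>

definition branching :: "(nat \<Rightarrow> bool) set \<Rightarrow> bool list \<Rightarrow> bool" where
  "branching P \<sigma> \<longleftrightarrow> \<sigma> @ [False] \<in> extendible P \<and> \<sigma> @ [True] \<in> extendible P"

text \<open>\<open>Psi_str P R m\<close> is the initial segment of length \<open>m\<close> of the path produced from \<open>R\<close>.\<close>

primrec Psi_str :: "(nat \<Rightarrow> bool) set \<Rightarrow> (nat \<Rightarrow> bool) \<Rightarrow> nat \<Rightarrow> bool list" where
  "Psi_str P R 0 = []"
| "Psi_str P R (Suc m) =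
    (let \<sigma> = Psi_str P R m
     in \<sigma> @ [if branching P \<sigma> then R (card {j. j < m \<and> branching P (take j \<sigma>)})
             else (THE i. \<sigma> @ [i] \<in> extendible P)])"

definition Psi :: "(nat \<Rightarrow> bool) set \<Rightarrow> (nat \<Rightarrow> bool) \<Rightarrow> (nat \<Rightarrow> bool)" where
  "Psi P R m = last (Psi_str P R (Suc m))"

definition randomly_produced_paths :: "(nat \<Rightarrow> bool) set \<Rightarrow> (nat \<Rightarrow> bool) set" where
  "randomly_produced_paths P = Psi P ` MLR (tree_oracle P)"

end

theory Submission imports Defs
begin

text \<open>Let \<open>A\<close> code the tree \<open>T\<^sub>P\<close>, and let \<open>branch_bits P \<sigma>\<close> list the bits chosen by \<open>\<sigma>\<close> at
  branching nodes of \<open>T\<^sub>P\<close>; on \<open>T\<^sub>P\<close> its length is \<open>\<theta>\<^sub>P \<sigma>\<close>. A path \<open>X\<close> is produced from \<open>R\<close> iff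
  all strings \<open>branch_bits P (X \<restriction>\<^bsub>seq\<^esub> n)\<close> are initial segments of \<open>R\<close>.

  If \<open>K\<^sup>A(X \<restriction>\<^bsub>seq\<^esub> n) + c \<le> \<theta>\<^sub>P(X \<restriction>\<^bsub>seq\<^esub> n)\<close> happens for every \<open>c\<close>, then \<open>R\<close> fails the test whose
  \<open>c\<close>-th component consists of the branching bits of all strings compressed by \<open>c\<close> bits; its measure
  is bounded by Kraft's inequality. Conversely, suppose that \<open>R\<close> fails a test \<open>V\<close> and that \<open>\<theta>\<^sub>P\<close> is
  unbounded along \<open>X\<close>. The strings of \<open>T\<^sub>P\<close> whose branching bits are seen to enter \<open>V (2 n + 1)\<close> by
  a stage equal to their length, and whose predecessor does not have this property, form a set that
  is decidable in \<open>A\<close>. Their branching bits have disjoint cylinders, so each of them can be given a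
  description that is about \<open>n\<close> bits shorter than \<open>\<theta>\<^sub>P\<close>; some initial segment of \<open>X\<close> is among them.
  If \<open>\<theta>\<^sub>P\<close> is bounded along \<open>X\<close>, then \<open>X\<close> is produced by every \<open>R\<close> in some cylinder, and
  almost all of these are random.\<close>

section \<open>Computable functions between coded types\<close>

text \<open>Injective codes let computability be stated for functions between pairs, options, lists
  and truth values, and be proved by closure rules that follow the shape of a lambda term.\<close>

class coded =
  fixes enc :: "'a \<Rightarrow> nat"
  assumes inj_enc: "inj enc"
begin

lemma enc_eq_iff [simp]: "enc x = enc y \<longleftrightarrow> x = y"
  using inj_enc by (simp add: inj_eq)

end

instantiation nat :: coded begin
definition "enc (n::nat) = n"
instance by standard (simp add: enc_nat_def inj_def)
end

instantiation bool :: coded begin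
definition "enc (b::bool) = (of_bool b :: nat)"
instance by standard (auto simp: enc_bool_def inj_def split: if_splits)
end

instantiation prod :: (coded, coded) coded begin
definition "enc (p::'a \<times> 'b) = prod_encode (enc (fst p), enc (snd p))"
instance by standard (auto simp: enc_prod_def inj_def prod_eq_iff)
end

instantiation option :: (coded) coded begin
definition "enc (p::'a option) = (case p of None \<Rightarrow> 0 | Some x \<Rightarrow> Suc (enc x))"
instance by standard (auto simp: enc_option_def inj_def split: option.splits)
end

instantiation list :: (coded) coded begin
definition "enc (l::'a list) = list_encode (map enc l)"
instance
  by standard (auto simp: enc_list_def inj_def list_encode_eq inj_enc
      intro: map_injective[OF _ inj_enc])
end

lemma enc_pair [simp]: "enc (x, y) = prod_encode (enc x, enc y)"
  by (simp add: enc_prod_def)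

lemma enc_option [simp]: "enc None = 0" "enc (Some x) = Suc (enc x)"
  by (simp_all add: enc_option_def)

lemma enc_list [simp]: "enc [] = 0" "enc (x # xs) = Suc (prod_encode (enc x, enc xs))"
  by (simp_all add: enc_list_def)

lemma enc_nat [simp]: "enc (n::nat) = n"
  by (simp add: enc_nat_def)

text \<open>The coding of strings used for oracles, tests and machines is an instance of the generic
  one, so the closure rules apply to strings directly.\<close>

lemma str_code_eq_enc: "str_code \<sigma> = enc \<sigma>"
  by (simp add: str_code_def enc_list_def enc_bool_def [abs_def])

section \<open>Total recursive functions on the natural numbers\<close>

definition total_recursive :: "nat set \<Rightarrow> (nat \<Rightarrow> nat) \<Rightarrow> bool" where
  "total_recursive A g \<longleftrightarrow> recursive_in A (\<lambda>x. Some (g x))"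

lemma total_recursive_comp:
  "total_recursive A f \<Longrightarrow> total_recursive A g \<Longrightarrow> total_recursive A (\<lambda>x. f (g x))"
  using recursive_in.comp[of A "\<lambda>x. Some (f x)" "\<lambda>x. Some (g x)"]
  by (simp add: total_recursive_def)

lemma total_recursive_pair:
  "total_recursive A f \<Longrightarrow> total_recursive A g \<Longrightarrow> total_recursive A (\<lambda>x. prod_encode (f x, g x))"
  using recursive_in.pair[of A "\<lambda>x. Some (f x)" "\<lambda>x. Some (g x)"]
  by (simp add: total_recursive_def)

lemma total_recursive_fst: "total_recursive A (\<lambda>x. fst (prod_decode x))"
  and total_recursive_snd: "total_recursive A (\<lambda>x. snd (prod_decode x))"
  and total_recursive_Suc: "total_recursive A Suc"
  by (auto simp: total_recursive_def intro: recursive_in.intros)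

lemma total_recursive_id: "total_recursive A (\<lambda>x. x)"
  using total_recursive_pair[OF total_recursive_fst total_recursive_snd] by simp

lemma total_recursive_const: "total_recursive A (\<lambda>_. n)"
proof (induction n)
  case 0
  show ?case by (simp add: total_recursive_def recursive_in.zero)
next
  case (Suc n)
  then show ?case using total_recursive_comp[OF total_recursive_Suc Suc] by simp
qed

text \<open>\<open>prec\<close> reads the recursion depth from its argument; composing with the pair
  of \<open>x\<close> and \<open>n x\<close> leaves \<open>x\<close> available to the step as a
  parameter.\<close>

lemma total_recursive_rec_nat:
  assumes f: "total_recursive A f" and h: "total_recursive A h" and n: "total_recursive A n"
  shows "total_recursive A (\<lambda>x. rec_nat (f x) (\<lambda>y r. h (prod_encode (x, prod_encode (y, r)))) (n x))"
proof -
  have rec: "rec_nat (Some (f a)) (\<lambda>y r. Option.bind r (\<lambda>i. Some (h (prod_encode (a, prod_encode (y, i)))))) k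
     = Some (rec_nat (f a) (\<lambda>y r. h (prod_encode (a, prod_encode (y, r)))) k)" for a k
    by (induction k) simp_all
  have "total_recursive A (\<lambda>x. case prod_decode x of (a, k) \<Rightarrow>
      rec_nat (f a) (\<lambda>y r. h (prod_encode (a, prod_encode (y, r)))) k)"
    using recursive_in.prec[OF f[unfolded total_recursive_def] h[unfolded total_recursive_def]]
    by (simp add: total_recursive_def rec case_prod_unfold)
  from total_recursive_comp[OF this total_recursive_pair[OF total_recursive_id n]]
  show ?thesis by simp
qed

text \<open>A realizer \<open>g\<close> is constrained only on codes; numbers that code nothing may
  be mapped anywhere.\<close>

definition computable_in :: "nat set \<Rightarrow> ('a::coded \<Rightarrow> 'b::coded) \<Rightarrow> bool" where
  "computable_in A f \<longleftrightarrow> (\<exists>g. total_recursive A g \<and> (\<forall>x. g (enc x) = enc (f x)))"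

named_theorems computable

lemma computable_inI: "total_recursive A g \<Longrightarrow> (\<And>x. g (enc x) = enc (f x)) \<Longrightarrow> computable_in A f"
  by (auto simp: computable_in_def)

lemma computable_inE:
  assumes "computable_in A f"
  obtains g where "total_recursive A g" "\<And>x. g (enc x) = enc (f x)"
  using assms by (auto simp: computable_in_def)

lemma computable_in_nat_iff:
  "computable_in A (f :: nat \<Rightarrow> 'a::coded) \<longleftrightarrow> total_recursive A (\<lambda>x. enc (f x))"
proof
  assume "computable_in A f"
  then obtain g where g: "total_recursive A g" "\<And>x. g (enc x) = enc (f x)"
    by (rule computable_inE) blast
  have "g = (\<lambda>x. enc (f x))" using g(2) by (auto simp: fun_eq_iff)
  then show "total_recursive A (\<lambda>x. enc (f x))" using g(1) by simp
qed (auto intro: computable_inI)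

lemma computable_comp:
  assumes "computable_in A f" "computable_in A g"
  shows "computable_in A (\<lambda>x. f (g x))"
proof -
  obtain f' where f': "total_recursive A f'" "\<And>x. f' (enc x) = enc (f x)"
    using assms(1) by (rule computable_inE) blast
  obtain g' where g': "total_recursive A g'" "\<And>x. g' (enc x) = enc (g x)"
    using assms(2) by (rule computable_inE) blast
  show ?thesis
    by (rule computable_inI[OF total_recursive_comp[OF f'(1) g'(1)]]) (simp add: f' g')
qed

text \<open>Functions with equal codes share their realizers. This covers coding and decoding maps,
  which act as the identity on codes.\<close>

lemma computable_recode:
  assumes "computable_in A f" "\<And>x. enc (f x) = enc (g x)"
  shows "computable_in A g"
  using assms unfolding computable_in_def by metis

lemma computable_id [computable]: "computable_in A (\<lambda>x. x)"
  by (rule computable_inI[OF total_recursive_id]) simp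

lemma computable_const [computable]: "computable_in A (\<lambda>_. c)"
  by (rule computable_inI[OF total_recursive_const]) simp

lemma computable_Pair [computable]:
  assumes "computable_in A f" "computable_in A g"
  shows "computable_in A (\<lambda>x. (f x, g x))"
proof -
  obtain f' where f': "total_recursive A f'" "\<And>x. f' (enc x) = enc (f x)"
    using assms(1) by (rule computable_inE) blast
  obtain g' where g': "total_recursive A g'" "\<And>x. g' (enc x) = enc (g x)"
    using assms(2) by (rule computable_inE) blast
  show ?thesis
    by (rule computable_inI[OF total_recursive_pair[OF f'(1) g'(1)]]) (simp add: f' g')
qed

lemma computable_comp2:
  assumes "computable_in A (\<lambda>z. h (fst z) (snd z))" "computable_in A f" "computable_in A g"
  shows "computable_in A (\<lambda>x. h (f x) (g x))"
  using computable_comp[OF assms(1) computable_Pair[OF assms(2,3)]] by simp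

lemma computable_comp3:
  assumes "computable_in A (\<lambda>z. h (fst z) (fst (snd z)) (snd (snd z)))"
    and "computable_in A f" "computable_in A g" "computable_in A k"
  shows "computable_in A (\<lambda>x. h (f x) (g x) (k x))"
  using computable_comp[OF assms(1) computable_Pair[OF assms(2) computable_Pair[OF assms(3,4)]]] by simp

lemma computable_fst [computable]:
  assumes "computable_in A f" shows "computable_in A (\<lambda>x. fst (f x))"
proof -
  have "computable_in A (fst :: 'b::coded \<times> 'c::coded \<Rightarrow> 'b)"
    by (rule computable_inI[OF total_recursive_fst]) (simp add: enc_prod_def)
  from computable_comp[OF this assms] show ?thesis .
qed

lemma computable_snd [computable]:
  assumes "computable_in A f" shows "computable_in A (\<lambda>x. snd (f x))"
proof -
  have "computable_in A (snd :: 'b::coded \<times> 'c::coded \<Rightarrow> 'c)"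
    by (rule computable_inI[OF total_recursive_snd]) (simp add: enc_prod_def)
  from computable_comp[OF this assms] show ?thesis .
qed

lemma computable_enc [computable]:
  assumes "computable_in A f" shows "computable_in A (\<lambda>x. enc (f x))"
  by (rule computable_recode[OF assms]) simp

lemma computable_prod_encode [computable]:
  assumes "computable_in A f" shows "computable_in A (\<lambda>x. prod_encode (f x))"
  by (rule computable_recode[OF assms]) (metis enc_nat enc_pair surj_pair)

lemma computable_prod_decode [computable]:
  assumes "computable_in A f" shows "computable_in A (\<lambda>x. prod_decode (f x))"
  by (rule computable_recode[OF assms]) (metis enc_nat enc_pair prod_decode_inverse surj_pair)

lemma computable_list_decode [computable]:
  assumes "computable_in A f" shows "computable_in A (\<lambda>x. list_decode (f x))"
  by (rule computable_recode[OF assms]) (simp add: enc_list_def enc_nat_def [abs_def])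

lemma computable_Suc [computable]:
  assumes "computable_in A f" shows "computable_in A (\<lambda>x. Suc (f x))"
proof -
  have "computable_in A Suc" by (rule computable_inI[OF total_recursive_Suc]) simp
  from computable_comp[OF this assms] show ?thesis .
qed

lemma computable_Some [computable]:
  assumes "computable_in A f" shows "computable_in A (\<lambda>x. Some (f x))"
  by (rule computable_recode[OF computable_Suc[OF computable_enc[OF assms]]]) simp

lemma computable_Cons [computable]:
  assumes "computable_in A f" "computable_in A g" shows "computable_in A (\<lambda>x. f x # g x)"
  by (rule computable_recode[OF computable_Suc[OF computable_enc[OF computable_Pair[OF assms]]]]) simp

lemma computable_mem_oracle [computable]:
  assumes "computable_in A f" shows "computable_in A (\<lambda>x. f x \<in> A)"
proof -
  have "computable_in A (\<lambda>x. x \<in> A)"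
    by (rule computable_inI[of _ "\<lambda>x. of_bool (x \<in> A)"])
      (simp_all add: total_recursive_def recursive_in.orac enc_bool_def)
  from computable_comp[OF this assms] show ?thesis .
qed

lemma computable_rec_nat [computable]:
  assumes "computable_in A f" "computable_in A (\<lambda>z. h (fst z) (fst (snd z)) (snd (snd z)))"
    "computable_in A n"
  shows "computable_in A (\<lambda>x. rec_nat (f x) (\<lambda>y r. h x y r) (n x))"
proof -
  obtain f' where f': "total_recursive A f'" "\<And>x. f' (enc x) = enc (f x)"
    using assms(1) by (rule computable_inE) blast
  obtain h' where h': "total_recursive A h'"
    "\<And>z. h' (enc z) = enc (h (fst z) (fst (snd z)) (snd (snd z)))"
    using assms(2) by (rule computable_inE) blast
  obtain n' where n': "total_recursive A n'" "\<And>x. n' (enc x) = enc (n x)"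
    using assms(3) by (rule computable_inE) blast
  have "rec_nat (enc (f x)) (\<lambda>y r. h' (prod_encode (enc x, prod_encode (y, r)))) k
      = enc (rec_nat (f x) (\<lambda>y r. h x y r) k)" for x k
    using h'(2)[of "(x, _, _)"] by (induction k) simp_all
  then show ?thesis
    by (intro computable_inI[OF total_recursive_rec_nat[OF f'(1) h'(1) n'(1)]]) (simp add: f' n')
qed

section \<open>Truth values, arithmetic and comparison\<close>

lemma computable_pred [computable]:
  assumes "computable_in A f" shows "computable_in A (\<lambda>x. f x - (1::nat))"
proof -
  have "rec_nat 0 (\<lambda>y r. y) n = n - 1" for n :: nat by (cases n) simp_all
  moreover have "computable_in A (\<lambda>x. rec_nat 0 (\<lambda>y r. y) (f x))"
    by (intro computable assms)
  ultimately show ?thesis by simp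
qed

lemma computable_if [computable]:
  assumes "computable_in A b" "computable_in A f" "computable_in A g"
  shows "computable_in A (\<lambda>x. if b x then f x else g x)"
proof -
  have b: "computable_in A (\<lambda>x. of_bool (b x) :: nat)"
    by (rule computable_recode[OF assms(1)]) (simp add: enc_bool_def)
  \<comment> \<open>The truth value, read as 0 or 1, is the depth of a recursion whose single step
    discards the start value.\<close>
  have "computable_in A (\<lambda>x. rec_nat (g x) (\<lambda>y r. f x) (of_bool (b x)))"
    by (intro computable_rec_nat b assms computable_comp[OF assms(2)] computable)
  moreover have "(\<lambda>x. rec_nat (g x) (\<lambda>y r. f x) (of_bool (b x))) = (\<lambda>x. if b x then f x else g x)"
    by auto
  ultimately show ?thesis by simp
qed

lemma computable_not [computable]:
  assumes "computable_in A b" shows "computable_in A (\<lambda>x. \<not> b x)"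
proof -
  have "computable_in A (\<lambda>x. if b x then False else True)" by (intro computable assms)
  moreover have "(\<lambda>x. if b x then False else True) = (\<lambda>x. \<not> b x)" by auto
  ultimately show ?thesis by simp
qed

lemma computable_conj [computable]:
  assumes "computable_in A b" "computable_in A c" shows "computable_in A (\<lambda>x. b x \<and> c x)"
proof -
  have "computable_in A (\<lambda>x. if b x then c x else False)" by (intro computable assms)
  moreover have "(\<lambda>x. if b x then c x else False) = (\<lambda>x. b x \<and> c x)" by auto
  ultimately show ?thesis by simp
qed

lemma computable_disj [computable]:
  assumes "computable_in A b" "computable_in A c" shows "computable_in A (\<lambda>x. b x \<or> c x)"
proof -
  have "computable_in A (\<lambda>x. if b x then True else c x)" by (intro computable assms)
  moreover have "(\<lambda>x. if b x then True else c x) = (\<lambda>x. b x \<or> c x)" by auto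
  ultimately show ?thesis by simp
qed

lemma computable_is_zero:
  assumes "computable_in A f" shows "computable_in A (\<lambda>x. f x = (0::nat))"
proof -
  have "computable_in A (\<lambda>x. rec_nat True (\<lambda>y r. False) (f x))" by (intro computable assms)
  moreover have "rec_nat True (\<lambda>y r. False) n \<longleftrightarrow> n = 0" for n by (cases n) auto
  ultimately show ?thesis by simp
qed

lemma computable_diff [computable]:
  assumes "computable_in A f" "computable_in A g" shows "computable_in A (\<lambda>x. f x - g x :: nat)"
proof -
  have "computable_in A (\<lambda>x. rec_nat (f x) (\<lambda>y r. r - 1) (g x))" by (intro computable assms)
  moreover have "rec_nat m (\<lambda>y r. r - 1) n = m - n" for m n :: nat by (induction n) auto
  ultimately show ?thesis by simp
qed

lemma computable_add [computable]:
  assumes "computable_in A f" "computable_in A g" shows "computable_in A (\<lambda>x. f x + g x :: nat)"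
proof -
  have "computable_in A (\<lambda>x. rec_nat (f x) (\<lambda>y r. Suc r) (g x))" by (intro computable assms)
  moreover have "rec_nat m (\<lambda>y r. Suc r) n = m + n" for m n :: nat by (induction n) auto
  ultimately show ?thesis by simp
qed

lemma computable_mult [computable]:
  assumes "computable_in A f" "computable_in A g" shows "computable_in A (\<lambda>x. f x * g x :: nat)"
proof -
  have "computable_in A (\<lambda>x. rec_nat 0 (\<lambda>y r. r + f x) (g x))"
    by (intro computable_rec_nat computable_comp[OF assms(1)] computable assms)
  moreover have "rec_nat 0 (\<lambda>y r. r + m) n = m * n" for m n :: nat by (induction n) auto
  ultimately show ?thesis by simp
qed

lemma computable_power2 [computable]:
  assumes "computable_in A f" shows "computable_in A (\<lambda>x. 2 ^ f x :: nat)"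
proof -
  have "computable_in A (\<lambda>x. rec_nat (1::nat) (\<lambda>y r. 2 * r) (f x))" by (intro computable assms)
  moreover have "rec_nat (1::nat) (\<lambda>y r. 2 * r) n = 2 ^ n" for n by (induction n) auto
  ultimately show ?thesis by simp
qed

lemma computable_le [computable]:
  assumes "computable_in A f" "computable_in A g" shows "computable_in A (\<lambda>x. f x \<le> (g x :: nat))"
  using computable_is_zero[OF computable_diff[OF assms]] by simp

lemma computable_less [computable]:
  assumes "computable_in A f" "computable_in A g" shows "computable_in A (\<lambda>x. f x < (g x :: nat))"
  using computable_le[OF computable_Suc[OF assms(1)] assms(2)] by (simp add: Suc_le_eq)

lemma computable_eq [computable]:
  assumes "computable_in A f" "computable_in A g" shows "computable_in A (\<lambda>x. f x = g x)"
proof -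
  have "computable_in A (\<lambda>x. enc (f x) \<le> enc (g x) \<and> enc (g x) \<le> enc (f x))"
    by (intro computable assms)
  moreover have "(\<lambda>x. enc (f x) \<le> enc (g x) \<and> enc (g x) \<le> enc (f x)) = (\<lambda>x. f x = g x)"
    by (auto simp: fun_eq_iff dest: antisym)
  ultimately show ?thesis by simp
qed

text \<open>Both \<open>Some\<close> and \<open>Cons\<close> are coded as the successor of the code of their arguments; hence
  case distinctions on options and on lists are both instances of the following one.\<close>

lemma computable_case_Suc_enc:
  assumes c: "computable_in A c" and f: "computable_in A f" and h: "computable_in A (\<lambda>z. h (fst z) (snd z))"
    and zero: "\<And>x. enc (c x) = 0 \<Longrightarrow> g x = f x"
    and Suc: "\<And>x n. enc (c x) = Suc n \<Longrightarrow> \<exists>y. n = enc y \<and> g x = h x y"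
  shows "computable_in A g"
proof -
  obtain c' where c': "total_recursive A c'" "\<And>x. c' (enc x) = enc (c x)"
    using c by (rule computable_inE) blast
  obtain f' where f': "total_recursive A f'" "\<And>x. f' (enc x) = enc (f x)"
    using f by (rule computable_inE) blast
  obtain h' where h': "total_recursive A h'" "\<And>z. h' (enc z) = enc (h (fst z) (snd z))"
    using h by (rule computable_inE) blast
  define k where "k z = h' (prod_encode (fst (prod_decode z), fst (prod_decode (snd (prod_decode z)))))" for z
  have "total_recursive A k"
    unfolding k_def
    by (intro total_recursive_comp[OF h'(1)] total_recursive_pair total_recursive_fst
        total_recursive_comp[OF total_recursive_fst] total_recursive_snd)
  from total_recursive_rec_nat[OF f'(1) this c'(1)]
  show ?thesis
  proof (rule computable_inI)
    fix x
    show "rec_nat (f' (enc x)) (\<lambda>y r. k (prod_encode (enc x, prod_encode (y, r)))) (c' (enc x)) = enc (g x)"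
    proof (cases "enc (c x)")
      case (Suc n)
      then obtain y where "n = enc y" "g x = h x y" using assms(5) by blast
      then show ?thesis using Suc h'(2)[of "(x, y)"] by (simp add: c' k_def)
    qed (simp add: c' f' zero)
  qed
qed

lemma computable_case_option [computable]:
  assumes "computable_in A f" "computable_in A (\<lambda>z. h (fst z) (snd z))" "computable_in A c"
  shows "computable_in A (\<lambda>x. case c x of None \<Rightarrow> f x | Some y \<Rightarrow> h x y)"
  by (rule computable_case_Suc_enc[OF assms(3,1,2)]) (auto split: option.splits)

lemma computable_case_list [computable]:
  assumes "computable_in A f" "computable_in A (\<lambda>z. h (fst z) (fst (snd z)) (snd (snd z)))" "computable_in A c"
  shows "computable_in A (\<lambda>x. case c x of [] \<Rightarrow> f x | y # ys \<Rightarrow> h x y ys)"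
proof (rule computable_case_Suc_enc[OF assms(3,1), where h = "\<lambda>x p. h x (fst p) (snd p)"])
  fix x n assume "enc (c x) = Suc n"
  then show "\<exists>y. n = enc y \<and> (case c x of [] \<Rightarrow> f x | y # ys \<Rightarrow> h x y ys) = h x (fst y) (snd y)"
    by (cases "c x") (auto intro!: exI[of _ "(_, _)"])
qed (use assms(2) in \<open>auto split: list.splits\<close>)

lemma computable_bind [computable]:
  assumes "computable_in A f" "computable_in A (\<lambda>z. h (fst z) (snd z))"
  shows "computable_in A (\<lambda>x. Option.bind (f x) (\<lambda>y. h x y))"
proof -
  have "computable_in A (\<lambda>x. case f x of None \<Rightarrow> None | Some y \<Rightarrow> h x y)"
    by (intro computable assms)
  moreover have "(case f x of None \<Rightarrow> None | Some y \<Rightarrow> h x y) = Option.bind (f x) (\<lambda>y. h x y)" for x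
    by (cases "f x") auto
  ultimately show ?thesis by simp
qed

text \<open>Bounds the number of steps of a fold by a computable quantity before
  \<open>length\<close> itself is known to be computable, since \<open>length\<close> is obtained
  from the fold.\<close>

lemma length_le_enc: "length xs \<le> enc xs"
proof (induction xs)
  case (Cons x xs)
  then show ?case using le_prod_encode_2[of "enc xs" "enc x"] by simp
qed simp

lemma computable_foldl [computable]:
  fixes h :: "'a::coded \<Rightarrow> 'b::coded \<Rightarrow> 'c::coded \<Rightarrow> 'b"
  assumes f: "computable_in A f" and h: "computable_in A (\<lambda>z. h (fst z) (fst (snd z)) (snd (snd z)))"
    and l: "computable_in A l"
  shows "computable_in A (\<lambda>x. foldl (\<lambda>a y. h x a y) (f x) (l x))"
proof -
  \<comment> \<open>One step consumes the head of the remaining list. On the empty list the state is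
    fixed, so running \<open>enc (l x)\<close> steps, possibly too many, still gives the value of
    the fold.\<close>
  define step where "step x p = (case snd p of [] \<Rightarrow> p | y # ys \<Rightarrow> (h x (fst p) y, ys))"
    for x and p :: "'b \<times> 'c list"
  have step: "computable_in A (\<lambda>z :: 'a \<times> nat \<times> 'b \<times> 'c list. step (fst z) (snd (snd z)))"
    unfolding step_def
    by (intro computable computable_comp3[OF h])
  have "computable_in A (\<lambda>x. fst (rec_nat (f x, l x) (\<lambda>_ p. step x p) (enc (l x))))"
    by (intro computable f l step)
  moreover have iter: "fst (rec_nat (a, xs) (\<lambda>_ p. step x p) n) = foldl (\<lambda>a y. h x a y) a xs"
    if "length xs \<le> n" for x a xs n
  proof -
    have "rec_nat (a, xs) (\<lambda>_ p. step x p) n = (step x ^^ n) (a, xs)" for n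
      by (induction n) simp_all
    moreover have "fst ((step x ^^ n) (a, xs)) = foldl (\<lambda>a y. h x a y) a xs"
      using that
    proof (induction n arbitrary: a xs)
      case (Suc n)
      show ?case
      proof (cases xs)
        case Nil
        have "(step x ^^ m) (a, []) = (a, [])" for m by (induction m) (simp_all add: step_def)
        then show ?thesis using Nil by (simp del: funpow.simps)
      next
        case (Cons y ys)
        have "(step x ^^ Suc n) (a, xs) = (step x ^^ n) (h x a y, ys)"
          by (simp add: funpow_Suc_right Cons step_def del: funpow.simps)
        then show ?thesis using Suc.IH[of ys "h x a y"] Suc.prems Cons by simp
      qed
    qed simp
    ultimately show ?thesis by simp
  qed
  ultimately show ?thesis by (simp add: iter length_le_enc)
qed

section \<open>Operations on lists and strings, bounded quantifiers\<close>

lemma foldl_Cons_eq: "foldl (\<lambda>a y. y # a) zs ys = rev ys @ zs"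
  by (induction ys arbitrary: zs) auto

lemma foldl_Suc_eq: "foldl (\<lambda>a y. Suc a) n ys = length ys + n"
  by (induction ys arbitrary: n) auto

lemma rev_tl_rev_eq: "rev (case rev ys of [] \<Rightarrow> [] | y # ys \<Rightarrow> ys) = butlast ys"
  by (cases ys rule: rev_cases) auto

lemma computable_rev [computable]:
  assumes "computable_in A f" shows "computable_in A (\<lambda>x. rev (f x))"
proof -
  have "computable_in A (\<lambda>x. foldl (\<lambda>a y. y # a) [] (f x))" by (intro computable assms)
  then show ?thesis by (simp add: foldl_Cons_eq)
qed

lemma computable_append [computable]:
  assumes "computable_in A f" "computable_in A g" shows "computable_in A (\<lambda>x. f x @ g x)"
proof -
  have "computable_in A (\<lambda>x. foldl (\<lambda>a y. y # a) (g x) (rev (f x)))" by (intro computable assms)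
  then show ?thesis by (simp add: foldl_Cons_eq)
qed

lemma computable_length [computable]:
  assumes "computable_in A f" shows "computable_in A (\<lambda>x. length (f x))"
proof -
  have "computable_in A (\<lambda>x. foldl (\<lambda>a y. Suc a) 0 (f x))" by (intro computable assms)
  then show ?thesis by (simp add: foldl_Suc_eq)
qed

lemma computable_butlast [computable]:
  assumes "computable_in A f" shows "computable_in A (\<lambda>x. butlast (f x))"
proof -
  have "computable_in A (\<lambda>x. rev (case rev (f x) of [] \<Rightarrow> [] | y # ys \<Rightarrow> ys))" by (intro computable assms)
  then show ?thesis by (simp add: rev_tl_rev_eq)
qed

text \<open>Every nonzero entry is read as \<open>True\<close>, which makes decoding total; a number
  that is not the code of a string decodes to a string with a different code.\<close>

definition str_decode :: "nat \<Rightarrow> bool list" where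
  "str_decode n = map (\<lambda>k. k \<noteq> 0) (list_decode n)"

lemma str_decode_enc [simp]: "str_decode (enc \<sigma>) = \<sigma>"
  by (simp add: str_decode_def enc_list_def enc_bool_def o_def)

lemma computable_str_decode [computable]:
  assumes "computable_in A f" shows "computable_in A (\<lambda>x. str_decode (f x))"
proof -
  have "computable_in A (\<lambda>x. rev (foldl (\<lambda>a k. (k \<noteq> 0) # a) [] (list_decode (f x))))"
    by (intro computable assms)
  moreover have "foldl (\<lambda>a k. (k \<noteq> 0) # a) zs ks = rev (map (\<lambda>k. k \<noteq> 0) ks) @ zs"
    for ks :: "nat list" and zs
    by (induction ks arbitrary: zs) auto
  ultimately show ?thesis by (simp add: str_decode_def)
qed

lemma computable_bounded_ex [computable]:
  fixes p :: "'a::coded \<Rightarrow> nat \<Rightarrow> bool"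
  assumes "computable_in A (\<lambda>z. p (fst z) (snd z))" "computable_in A n"
  shows "computable_in A (\<lambda>x. \<exists>m<n x. p x m)"
proof -
  have "computable_in A (\<lambda>x. rec_nat False (\<lambda>m r. r \<or> p x m) (n x))"
    by (intro computable computable_comp2[OF assms(1)] assms(2))
  moreover have "rec_nat False (\<lambda>m r. r \<or> p x m) k \<longleftrightarrow> (\<exists>m<k. p x m)" for x k
    by (induction k) (auto simp: less_Suc_eq)
  ultimately show ?thesis by simp
qed

lemma computable_bounded_all [computable]:
  fixes p :: "'a::coded \<Rightarrow> nat \<Rightarrow> bool"
  assumes "computable_in A (\<lambda>z. p (fst z) (snd z))" "computable_in A n"
  shows "computable_in A (\<lambda>x. \<forall>m<n x. p x m)"
proof -
  have "computable_in A (\<lambda>x. \<not> (\<exists>m<n x. \<not> p x m))" by (intro computable assms)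
  then show ?thesis by simp
qed

section \<open>Unbounded search and stage approximations\<close>

text \<open>Two such \<open>n\<close> cannot coexist, as \<open>h\<close> at the smaller one would
  be both 0 and a successor; hence \<open>LEAST\<close> returns the only candidate.\<close>

lemma minimize_eq_Some_iff:
  "minimize h = Some n \<longleftrightarrow> h n = Some 0 \<and> (\<forall>m<n. \<exists>k. h m = Some (Suc k))"
proof -
  define zero where "zero n \<longleftrightarrow> h n = Some 0 \<and> (\<forall>m<n. \<exists>k. h m = Some (Suc k))" for n
  have eq: "n = m" if "zero n" "zero m" for n m
    using that unfolding zero_def
    by (metis linorder_neqE_nat nat.distinct(1) option.inject)
  then have least: "(LEAST n. zero n) = n" if "zero n" for n
    using eq[OF LeastI[of zero, OF that] that] by simp
  have "minimize h = (if \<exists>n. zero n then Some (LEAST n. zero n) else None)"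
    by (simp add: minimize_def zero_def Let_def)
  then have "minimize h = Some n \<longleftrightarrow> zero n"
    using least by auto
  then show ?thesis by (simp add: zero_def)
qed

text \<open>The form in which machines and enumerations are presented: \<open>x\<close> is the
  input, the second component is the witness sought, and \<open>q\<close> reads the output off the
  least witness.\<close>

lemma recursive_in_search:
  fixes p :: "nat \<times> nat \<Rightarrow> bool" and q :: "nat \<times> nat \<Rightarrow> 'a::coded"
  assumes p: "computable_in A p" and q: "computable_in A q"
  shows "recursive_in A (\<lambda>x. if \<exists>z. p (x, z) then Some (enc (q (x, LEAST z. p (x, z)))) else None)"
proof -
  have "computable_in A (\<lambda>w. if p (prod_decode w) then 0 else 1 :: nat)"
    by (intro computable computable_comp[OF p])
  then have "recursive_in A (\<lambda>w. Some (if p (prod_decode w) then 0 else 1))"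
    by (simp add: computable_in_nat_iff total_recursive_def)
  from recursive_in.mu[OF this]
  have rec: "recursive_in A (\<lambda>x. minimize (\<lambda>z. Some (if p (x, z) then 0 else 1)))" by simp
  have minimize: "minimize (\<lambda>z. Some (if P z then 0 else 1)) = (if \<exists>z. P z then Some (LEAST z. P z) else None)"
    for P
  proof (cases "\<exists>z. P z")
    case True
    define l where "l = (LEAST z. P z)"
    have "P l" unfolding l_def by (rule LeastI_ex[OF True])
    moreover have "\<not> P m" if "m < l" for m using that not_less_Least unfolding l_def by blast
    ultimately have "minimize (\<lambda>z. Some (if P z then 0 else 1)) = Some l"
      by (simp add: minimize_eq_Some_iff)
    with True show ?thesis by (simp add: l_def)
  next
    case False
    then show ?thesis by (simp add: minimize_def Let_def)
  qed
  have id: "recursive_in A (\<lambda>x. Some x)"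
    using total_recursive_id by (simp add: total_recursive_def)
  have "computable_in A (\<lambda>w. enc (q (prod_decode w)))"
    by (intro computable computable_comp[OF q])
  then have out: "recursive_in A (\<lambda>w. Some (enc (q (prod_decode w))))"
    by (simp add: computable_in_nat_iff total_recursive_def)
  have "recursive_in A (\<lambda>x. Option.bind (Option.bind (Some x) (\<lambda>y.
      Option.bind (minimize (\<lambda>z. Some (if p (x, z) then 0 else 1))) (\<lambda>z. Some (prod_encode (y, z)))))
      (\<lambda>w. Some (enc (q (prod_decode w)))))"
    by (rule recursive_in.comp[OF out recursive_in.pair[OF id rec]])
  also have "(\<lambda>x. Option.bind (Option.bind (Some x) (\<lambda>y.
      Option.bind (minimize (\<lambda>z. Some (if p (x, z) then 0 else 1))) (\<lambda>z. Some (prod_encode (y, z)))))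
      (\<lambda>w. Some (enc (q (prod_decode w)))))
    = (\<lambda>x. if \<exists>z. p (x, z) then Some (enc (q (x, LEAST z. p (x, z)))) else None)"
    unfolding minimize by (rule ext) simp
  finally show ?thesis .
qed

lemma ce_in_range:
  fixes p :: "nat \<Rightarrow> bool" and q :: "nat \<Rightarrow> 'a::coded"
  assumes "computable_in A p" "computable_in A q"
  shows "ce_in A {enc (q z) | z. p z}"
proof -
  have "computable_in A (\<lambda>w :: nat \<times> nat. p (snd w) \<and> enc (q (snd w)) = fst w)"
    by (intro computable computable_comp[OF assms(1)] computable_comp[OF assms(2)])
  from recursive_in_search[OF this computable_const[where c = "0::nat"]]
  have "recursive_in A (\<lambda>x. if \<exists>z. p z \<and> enc (q z) = x then Some 0 else None)" (is "recursive_in A ?f")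
    unfolding enc_nat fst_conv snd_conv .
  moreover have "{enc (q z) | z. p z} = dom ?f" by (auto simp: dom_def split: if_splits)
  ultimately show ?thesis unfolding ce_in_def by blast
qed

lemma computable_bounded_Least [computable]:
  fixes p :: "'a::coded \<Rightarrow> nat \<Rightarrow> bool"
  assumes "computable_in A (\<lambda>z. p (fst z) (snd z))" "computable_in A n"
  shows "computable_in A (\<lambda>x. if \<exists>m<n x. p x m then Some (LEAST m. p x m) else None)"
proof -
  \<comment> \<open>Once a value has been found the recursion keeps it, so the first success is the
    least one.\<close>
  define step where "step x m r = (if r \<noteq> None then r else if p x m then Some m else None)" for x m r
  have "computable_in A (\<lambda>x. rec_nat None (\<lambda>m r. step x m r) (n x))"
    unfolding step_def by (intro computable computable_comp2[OF assms(1)] assms(2))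
  moreover have "rec_nat None (\<lambda>m r. step x m r) k = (if \<exists>m<k. p x m then Some (LEAST m. p x m) else None)" for x k
  proof (induction k)
    case (Suc k)
    have "(LEAST m. p x m) = k" if "p x k" "\<not> (\<exists>m<k. p x m)"
      using that by (intro Least_equality) (auto simp: not_less[symmetric])
    then show ?case using Suc by (auto simp: step_def less_Suc_eq)
  qed simp
  ultimately show ?thesis by simp
qed

section \<open>Approximation of partial functions by stages\<close>

definition approximates :: "(nat \<times> nat \<Rightarrow> nat option) \<Rightarrow> (nat \<Rightarrow> nat option) \<Rightarrow> bool" where
  "approximates g f \<longleftrightarrow>
    (\<forall>x s t y. g (x, s) = Some y \<longrightarrow> s \<le> t \<longrightarrow> g (x, t) = Some y) \<and>
    (\<forall>x y. f x = Some y \<longleftrightarrow> (\<exists>s. g (x, s) = Some y))"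

lemma approximates_mono: "approximates g f \<Longrightarrow> g (x, s) = Some y \<Longrightarrow> s \<le> t \<Longrightarrow> g (x, t) = Some y"
  and approximates_iff: "approximates g f \<Longrightarrow> f x = Some y \<longleftrightarrow> (\<exists>s. g (x, s) = Some y)"
  unfolding approximates_def by blast+

text \<open>Both computations have halted by the larger of their two halting stages.\<close>

lemma approximates_bind:
  assumes f: "approximates gf f" and h: "\<And>a. approximates (gh a) (h a)"
  shows "approximates (\<lambda>(x, s). Option.bind (gf (x, s)) (\<lambda>y. gh y (x, s))) (\<lambda>x. Option.bind (f x) (\<lambda>y. h y x))"
  unfolding approximates_def
proof (intro conjI allI impI)
  fix x s t y
  assume "(case (x, s) of (x, s) \<Rightarrow> Option.bind (gf (x, s)) (\<lambda>y. gh y (x, s))) = Some y" "s \<le> t"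
  then show "(case (x, t) of (x, s) \<Rightarrow> Option.bind (gf (x, s)) (\<lambda>y. gh y (x, s))) = Some y"
    by (auto simp: bind_eq_Some_conv intro: approximates_mono[OF f] approximates_mono[OF h])
next
  fix x y
  show "Option.bind (f x) (\<lambda>y. h y x) = Some y \<longleftrightarrow>
    (\<exists>s. (case (x, s) of (x, s) \<Rightarrow> Option.bind (gf (x, s)) (\<lambda>y. gh y (x, s))) = Some y)"
  proof
    assume "Option.bind (f x) (\<lambda>y. h y x) = Some y"
    then obtain a where a: "f x = Some a" "h a x = Some y" by (auto simp: bind_eq_Some_conv)
    then obtain s t where "gf (x, s) = Some a" "gh a (x, t) = Some y"
      using approximates_iff[OF f] approximates_iff[OF h] by blast
    then have "gf (x, max s t) = Some a" "gh a (x, max s t) = Some y"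
      using approximates_mono[OF f] approximates_mono[OF h] by (meson max.cobounded1 max.cobounded2)+
    then show "\<exists>s. (case (x, s) of (x, s) \<Rightarrow> Option.bind (gf (x, s)) (\<lambda>y. gh y (x, s))) = Some y"
      by (intro exI[of _ "max s t"]) simp
  qed (auto simp: bind_eq_Some_conv approximates_iff[OF f] approximates_iff[OF h])
qed

lemma approximates_total: "approximates (\<lambda>(x, s). Some (h x)) (\<lambda>x. Some (h x))"
  by (simp add: approximates_def)

lemma approximates_reindex: "approximates g f \<Longrightarrow> approximates (\<lambda>(x, s). g (k x, s)) (\<lambda>x. f (k x))"
  unfolding approximates_def prod.case by blast

lemma approximates_rec_nat:
  assumes f: "approximates gf f" and h: "approximates gh h"
  shows "approximates
      (\<lambda>(x, s). rec_nat (gf (a x, s)) (\<lambda>y r. Option.bind r (\<lambda>i. gh (b x y i, s))) (n x))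
      (\<lambda>x. rec_nat (f (a x)) (\<lambda>y r. Option.bind r (\<lambda>i. h (b x y i))) (n x))"
proof -
  have "approximates
      (\<lambda>(x, s). rec_nat (gf (a x, s)) (\<lambda>y r. Option.bind r (\<lambda>i. gh (b x y i, s))) k)
      (\<lambda>x. rec_nat (f (a x)) (\<lambda>y r. Option.bind r (\<lambda>i. h (b x y i))) k)" for k
  proof (induction k)
    case 0
    then show ?case using approximates_reindex[OF f, of a] by simp
  next
    case (Suc k)
    have "approximates (\<lambda>(x, s). gh (b x k i, s)) (\<lambda>x. h (b x k i))" for i
      by (rule approximates_reindex[OF h])
    from approximates_bind[OF Suc this] show ?case
      by simp
  qed
  \<comment> \<open>The defining conditions concern one argument \<open>x\<close> at a time, so the
    depth may be specialised to \<open>n x\<close> although the induction fixed it independently of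
    \<open>x\<close>.\<close>
  note this[unfolded approximates_def prod.case, rule_format]
  then show ?thesis
    unfolding approximates_def prod.case by (intro conjI allI impI) meson+
qed

text \<open>At stage \<open>s\<close> only candidates below \<open>s\<close> are tested, which keeps
  the search bounded; a minimum is eventually confirmed because it depends on finitely many
  values.\<close>

lemma approximates_minimize:
  assumes f: "approximates g f"
  shows "approximates
      (\<lambda>(x, s). if \<exists>n<s. g (b x n, s) = Some 0 \<and> (\<forall>m<n. \<exists>k. g (b x m, s) = Some (Suc k))
        then Some (LEAST n. g (b x n, s) = Some 0 \<and> (\<forall>m<n. \<exists>k. g (b x m, s) = Some (Suc k))) else None)
      (\<lambda>x. minimize (\<lambda>n. f (b x n)))" (is "approximates (\<lambda>(x, s). ?G x s) _")
proof -
  define Z where "Z x s n \<longleftrightarrow> g (b x n, s) = Some 0 \<and> (\<forall>m<n. \<exists>k. g (b x m, s) = Some (Suc k))" for x s n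
  have unique: "n = m" if "Z x s n" "Z x s m" for x s n m
    using that unfolding Z_def by (metis linorder_neqE_nat nat.distinct(1) option.inject)
  have G: "?G x s = Some n \<longleftrightarrow> n < s \<and> Z x s n" for x s n
  proof -
    have "(LEAST n. Z x s n) = m" if "Z x s m" for m
      using unique[OF LeastI[of "Z x s", OF that] that] by simp
    then show ?thesis unfolding Z_def[symmetric] using unique by auto
  qed
  have mono: "Z x t n" if "Z x s n" "s \<le> t" for x s t n
    using that approximates_mono[OF f] unfolding Z_def by metis
  have limit: "minimize (\<lambda>n. f (b x n)) = Some n \<longleftrightarrow> (\<exists>s. n < s \<and> Z x s n)" for x n
  proof
    assume "minimize (\<lambda>n. f (b x n)) = Some n"
    then have "f (b x n) = Some 0" and "\<forall>m\<in>{..<n}. \<exists>k. f (b x m) = Some (Suc k)"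
      by (auto simp: minimize_eq_Some_iff)
    then obtain s where s: "g (b x n, s) = Some 0"
      and "\<forall>m\<in>{..<n}. \<exists>t k. g (b x m, t) = Some (Suc k)"
      using approximates_iff[OF f] by blast
    then obtain T where T: "\<forall>m\<in>{..<n}. \<exists>k. g (b x m, T m) = Some (Suc k)" by metis
    \<comment> \<open>This stage exceeds \<open>n\<close>, \<open>s\<close> and every
      \<open>T m\<close>, so all the values needed are present and \<open>n\<close> is among the
      candidates.\<close>
    define u where "u = Suc (n + s + (\<Sum>m<n. T m))"
    have "T m \<le> u" if "m < n" for m
      using member_le_sum[of m "{..<n}" T] that by (simp add: u_def)
    with T have "\<forall>m<n. \<exists>k. g (b x m, u) = Some (Suc k)"
      using approximates_mono[OF f] by (metis lessThan_iff)
    moreover have "g (b x n, u) = Some 0" "n < u"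
      using approximates_mono[OF f s, of u] by (auto simp: u_def)
    ultimately show "\<exists>s. n < s \<and> Z x s n" unfolding Z_def by blast
  next
    assume "\<exists>s. n < s \<and> Z x s n"
    then show "minimize (\<lambda>n. f (b x n)) = Some n"
      unfolding Z_def minimize_eq_Some_iff using approximates_iff[OF f] by metis
  qed
  show ?thesis
    unfolding approximates_def prod.case G limit using mono by (meson less_le_trans)
qed

text \<open>The step-bounded computations of Kleene's normal form theorem, obtained without coding
  programs by numbers: \<open>g (x, s)\<close> is the value of \<open>f x\<close> if it is found by stage \<open>s\<close>.\<close>

lemma stage_approximation:
  assumes "recursive_in A f"
  obtains g where "computable_in A g" "approximates g f"
proof -
  have "\<exists>g. computable_in A g \<and> approximates g f"
    using assms
  proof induction
    case zero
    show ?case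
      by (intro exI[of _ "\<lambda>(x, s). Some 0"] conjI approximates_total)
        (simp add: case_prod_unfold computable_const)
  next
    case succ
    show ?case
      by (intro exI[of _ "\<lambda>(x, s). Some (Suc x)"] conjI approximates_total)
        (unfold case_prod_unfold, intro computable)
  next
    case left
    show ?case
      by (intro exI[of _ "\<lambda>(x, s). Some (fst (prod_decode x))"] conjI approximates_total)
        (unfold case_prod_unfold, intro computable)
  next
    case right
    show ?case
      by (intro exI[of _ "\<lambda>(x, s). Some (snd (prod_decode x))"] conjI approximates_total)
        (unfold case_prod_unfold, intro computable)
  next
    case orac
    have "computable_in A (\<lambda>(x, s :: nat). Some (enc (x \<in> A)))"
      by (unfold case_prod_unfold, intro computable)
    then show ?case
      by (intro exI[of _ "\<lambda>(x, s). Some (of_bool (x \<in> A))"] conjI approximates_total)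
        (simp add: enc_bool_def)
  next
    case (pair f h)
    then obtain gf gh where g: "computable_in A gf" "approximates gf f"
      "computable_in A gh" "approximates gh h" by blast
    let ?g = "\<lambda>(x, s). Option.bind (gf (x, s)) (\<lambda>y. Option.bind (gh (x, s)) (\<lambda>z. Some (prod_encode (y, z))))"
    have "computable_in A ?g"
      unfolding case_prod_unfold
      by (intro computable computable_comp[OF g(1)] computable_comp[OF g(3)])
    moreover have "approximates ?g (\<lambda>x. Option.bind (f x) (\<lambda>y. Option.bind (h x) (\<lambda>z. Some (prod_encode (y, z)))))"
      using approximates_bind[OF g(2) approximates_bind[OF g(4) approximates_total]]
      by (simp add: case_prod_unfold)
    ultimately show ?case by blast
  next
    case (comp f h)
    then obtain gf gh where g: "computable_in A gf" "approximates gf f"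
      "computable_in A gh" "approximates gh h" by blast
    let ?g = "\<lambda>(x, s). Option.bind (gh (x, s)) (\<lambda>y. gf (y, s))"
    have "computable_in A ?g"
      unfolding case_prod_unfold
      by (intro computable computable_comp[OF g(1)] computable_comp[OF g(3)])
    moreover have "approximates ?g (\<lambda>x. Option.bind (h x) f)"
      using approximates_bind[OF g(4) approximates_reindex[OF g(2)], of "\<lambda>y x. y"]
      by (simp add: case_prod_unfold)
    ultimately show ?case by blast
  next
    case (prec f h)
    then obtain gf gh where g: "computable_in A gf" "approximates gf f"
      "computable_in A gh" "approximates gh h" by blast
    let ?g = "\<lambda>(x, s). rec_nat (gf (fst (prod_decode x), s))
      (\<lambda>y r. Option.bind r (\<lambda>i. gh (prod_encode (fst (prod_decode x), prod_encode (y, i)), s))) (snd (prod_decode x))"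
    have "computable_in A ?g"
      unfolding case_prod_unfold
      by (intro computable computable_comp[OF g(1)] computable_comp[OF g(3)])
    moreover have "approximates ?g (\<lambda>x. case prod_decode x of (a, n) \<Rightarrow>
      rec_nat (f a) (\<lambda>y r. Option.bind r (\<lambda>i. h (prod_encode (a, prod_encode (y, i))))) n)"
      using approximates_rec_nat[OF g(2,4), of "\<lambda>x. fst (prod_decode x)"
          "\<lambda>x y i. prod_encode (fst (prod_decode x), prod_encode (y, i))" "\<lambda>x. snd (prod_decode x)"]
      by (simp add: case_prod_unfold)
    ultimately show ?case by blast
  next
    case (mu f)
    then obtain g where g: "computable_in A g" "approximates g f" by blast
    \<comment> \<open>Decidable form of the clause that quantifies over \<open>k\<close>, to which
      the closure rules apply.\<close>
    define pos where "pos r \<longleftrightarrow> (case r of None \<Rightarrow> False | Some k \<Rightarrow> k \<noteq> (0::nat))" for r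
    have pos: "pos r \<longleftrightarrow> (\<exists>k. r = Some (Suc k))" for r
      by (auto simp: pos_def gr0_conv_Suc split: option.splits)
    have "computable_in A (\<lambda>(x, s). if \<exists>n<s. g (prod_encode (x, n), s) = Some 0 \<and>
          (\<forall>m<n. pos (g (prod_encode (x, m), s)))
        then Some (LEAST n. g (prod_encode (x, n), s) = Some 0 \<and>
          (\<forall>m<n. pos (g (prod_encode (x, m), s)))) else None)"
      unfolding case_prod_unfold pos_def
      by (intro computable computable_comp[OF g(1)])
    then show ?case
      using approximates_minimize[OF g(2), of "\<lambda>x n. prod_encode (x, n)"] unfolding pos by blast
  qed
  then show ?thesis using that by blast
qed

text \<open>Membership is convergence; convergence by stage \<open>s\<close> is decidable in the
  oracle and persists at later stages.\<close>

lemma ce_in_stages: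
  assumes "ce_in A (enc ` S)"
  shows "\<exists>p :: 'a::coded \<times> nat \<Rightarrow> bool. computable_in A p \<and>
    (\<forall>x s t. p (x, s) \<longrightarrow> s \<le> t \<longrightarrow> p (x, t)) \<and> (\<forall>x. x \<in> S \<longleftrightarrow> (\<exists>s. p (x, s)))"
proof -
  obtain f where f: "recursive_in A f" "enc ` S = dom f" using assms by (auto simp: ce_in_def)
  obtain g where g: "computable_in A g" "approximates g f" by (rule stage_approximation[OF f(1)])
  define p where "p z \<longleftrightarrow> g (enc (fst z), snd z) \<noteq> None" for z :: "'a \<times> nat"
  show ?thesis
  proof (rule exI[of _ p], intro conjI allI impI)
    show "computable_in A p"
      unfolding p_def by (intro computable computable_comp[OF g(1)])
    show "p (x, t)" if "p (x, s)" "s \<le> t" for x s t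
      using that approximates_mono[OF g(2)] unfolding p_def fst_conv snd_conv by blast
    show "x \<in> S \<longleftrightarrow> (\<exists>s. p (x, s))" for x
    proof -
      have "x \<in> S \<longleftrightarrow> enc x \<in> dom f" using f(2) by (metis image_iff enc_eq_iff)
      then show ?thesis unfolding p_def dom_def fst_conv snd_conv using approximates_iff[OF g(2)] by auto
    qed
  qed
qed

section \<open>Prefix-free machines from bounded request sets\<close>

text \<open>The most significant bit comes first: \<open>\<tau>\<close> stands for the dyadic
  interval from \<open>bin_value \<tau> / 2 ^ length \<tau>\<close> to
  \<open>Suc (bin_value \<tau>) / 2 ^ length \<tau>\<close>.\<close>

definition bin_value :: "bool list \<Rightarrow> nat" where
  "bin_value \<tau> = foldl (\<lambda>a b. 2 * a + of_bool b) 0 \<tau>"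

lemma bin_value_Nil [simp]: "bin_value [] = 0"
  and bin_value_snoc [simp]: "bin_value (\<tau> @ [b]) = 2 * bin_value \<tau> + of_bool b"
  by (simp_all add: bin_value_def)

lemma computable_of_bool [computable]:
  assumes "computable_in A b" shows "computable_in A (\<lambda>x. of_bool (b x) :: nat)"
  by (rule computable_recode[OF assms]) (simp add: enc_bool_def)

lemma computable_bin_value [computable]:
  assumes "computable_in A f" shows "computable_in A (\<lambda>x. bin_value (f x))"
  unfolding bin_value_def by (intro computable assms)

lemma bin_value_append_bounds:
  "bin_value \<tau> * 2 ^ length \<rho> \<le> bin_value (\<tau> @ \<rho>)"
  "bin_value (\<tau> @ \<rho>) < Suc (bin_value \<tau>) * 2 ^ length \<rho>"
proof (induction \<rho> rule: rev_induct)
  case (snoc b \<rho>)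
  {
    case 1
    show ?case using snoc(1) by (simp flip: append_assoc)
  next
    case 2
    show ?case using snoc(2) by (simp flip: append_assoc add: of_bool_def)
  }
qed simp_all

lemma bin_value_surj: "k < 2 ^ n \<Longrightarrow> \<exists>\<tau>. length \<tau> = n \<and> bin_value \<tau> = k"
proof (induction n arbitrary: k)
  case (Suc n)
  then have "k div 2 < 2 ^ n" by simp
  with Suc.IH obtain \<tau> where "length \<tau> = n" "bin_value \<tau> = k div 2" by blast
  then show ?case by (intro exI[of _ "\<tau> @ [odd k]"]) (auto simp: of_bool_def)
qed simp

text \<open>A request \<open>i\<close> with \<open>v i\<close> asks for a description of length \<open>r i + 1\<close> of the string
  \<open>out i\<close>. The requests are served by consecutive subintervals of the unit interval, the one of
  length \<open>(1/2) ^ r i\<close> starting at the total weight of the previous requests; it contains a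
  dyadic interval of half its length, whose string is the description. This loses one bit compared
  to the Kraft-Chaitin theorem.\<close>

lemma machine_existence:
  fixes v :: "nat \<Rightarrow> bool" and r :: "nat \<Rightarrow> nat" and out :: "nat \<Rightarrow> bool list"
  assumes v: "computable_in A v" and r: "computable_in A r" and out: "computable_in A out"
    and bound: "\<And>n. (\<Sum>i<n. if v i then (1/2) ^ r i else 0) \<le> (1::real)"
  obtains M where "prefix_free_machine A M"
    "\<And>i. v i \<Longrightarrow> \<exists>\<tau>. M \<tau> = Some (out i) \<and> length \<tau> = Suc (r i)"
proof -
  define weight :: "nat \<Rightarrow> real" where "weight n = (\<Sum>i<n. if v i then (1/2) ^ r i else 0)" for n
  \<comment> \<open>The partial sums are carried as numerator and exponent of a dyadic fraction, so
    that comparisons with them are decided by natural number arithmetic.\<close>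
  define frac :: "nat \<Rightarrow> nat \<times> nat" where
    "frac n = rec_nat (0, 0) (\<lambda>i q. if v i then (fst q * 2 ^ r i + 2 ^ snd q, snd q + r i) else q) n" for n
  have frac: "weight n = fst (frac n) / 2 ^ snd (frac n)" for n
    by (induction n) (auto simp: weight_def frac_def field_simps power_add)
  \<comment> \<open>Inclusion of the dyadic interval of \<open>\<tau>\<close> in the one reserved
    for request \<open>i\<close>, with denominators cleared; the summand
    \<open>2 * 2 ^ snd (frac i)\<close> comes from
    \<open>(1/2) ^ r i = 2 / 2 ^ length \<tau>\<close>.\<close>
  define serves where "serves \<tau> i \<longleftrightarrow> v i \<and> length \<tau> = Suc (r i) \<and>
      fst (frac i) * 2 ^ length \<tau> \<le> bin_value \<tau> * 2 ^ snd (frac i) \<and>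
      Suc (bin_value \<tau>) * 2 ^ snd (frac i) \<le> fst (frac i) * 2 ^ length \<tau> + 2 * 2 ^ snd (frac i)" for \<tau> i
  have serves_iff: "serves \<tau> i \<longleftrightarrow> v i \<and> length \<tau> = Suc (r i) \<and>
      weight i \<le> bin_value \<tau> / 2 ^ length \<tau> \<and>
      Suc (bin_value \<tau>) / 2 ^ length \<tau> \<le> weight i + (1/2) ^ r i" for \<tau> i
  proof -
    have "fst (frac i) * 2 ^ length \<tau> \<le> bin_value \<tau> * 2 ^ snd (frac i) \<longleftrightarrow>
        real (fst (frac i) * 2 ^ length \<tau>) \<le> real (bin_value \<tau> * 2 ^ snd (frac i))"
      by (rule of_nat_le_iff[symmetric])
    also have "\<dots> \<longleftrightarrow> weight i \<le> bin_value \<tau> / 2 ^ length \<tau>"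
      by (simp add: frac field_simps)
    finally have lower: "fst (frac i) * 2 ^ length \<tau> \<le> bin_value \<tau> * 2 ^ snd (frac i) \<longleftrightarrow>
      weight i \<le> bin_value \<tau> / 2 ^ length \<tau>" .
    have "Suc (bin_value \<tau>) * 2 ^ snd (frac i) \<le> fst (frac i) * 2 ^ length \<tau> + 2 * 2 ^ snd (frac i) \<longleftrightarrow>
        real (Suc (bin_value \<tau>) * 2 ^ snd (frac i)) \<le> real (fst (frac i) * 2 ^ length \<tau> + 2 * 2 ^ snd (frac i))"
      by (rule of_nat_le_iff[symmetric])
    also have "\<dots> \<longleftrightarrow> Suc (bin_value \<tau>) / 2 ^ length \<tau> \<le> weight i + 2 / 2 ^ length \<tau>"
    proof -
      have "b * E \<le> F * G + 2 * E \<longleftrightarrow> b / G \<le> F / E + 2 / G" if "E > 0" "G > 0" for b E F G :: real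
      proof -
        have "F / E + 2 / G = (F * G + 2 * E) / (E * G)" using that by (simp add: field_simps)
        moreover have "b / G = (b * E) / (E * G)" using that by simp
        ultimately show ?thesis using mult_pos_pos[OF that] by (simp only: divide_le_cancel) auto
      qed
      then show ?thesis
        unfolding frac of_nat_mult of_nat_add of_nat_power of_nat_numeral by this simp_all
    qed
    finally show ?thesis
      unfolding serves_def lower by (auto simp: power_one_over)
  qed
  have weight_less: "weight i + (1/2) ^ r i \<le> weight j" if "v i" "i < j" for i j
  proof -
    have "weight (Suc i) \<le> weight j" unfolding weight_def
      using that by (intro sum_mono2) auto
    then show ?thesis using that by (simp add: weight_def)
  qed
  \<comment> \<open>If one description extends another, their dyadic intervals overlap, whereas
    distinct requests occupy non-overlapping intervals. The case of empty \<open>\<rho>\<close>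
    shows that a description serves at most one request.\<close>
  have unique: "i = j" if "serves \<tau> i" "serves (\<tau> @ \<rho>) j" for \<tau> \<rho> i j
  proof (rule ccontr)
    let ?lo = "\<lambda>\<tau>. bin_value \<tau> / 2 ^ length \<tau> :: real" and ?hi = "\<lambda>\<tau>. Suc (bin_value \<tau>) / 2 ^ length \<tau> :: real"
    have "real (bin_value \<tau> * 2 ^ length \<rho>) \<le> real (bin_value (\<tau> @ \<rho>))"
      "real (bin_value (\<tau> @ \<rho>)) < real (Suc (bin_value \<tau>) * 2 ^ length \<rho>)"
      using bin_value_append_bounds[of \<tau> \<rho>] of_nat_le_iff of_nat_less_iff by blast+
    then have lo: "?lo \<tau> \<le> ?lo (\<tau> @ \<rho>)" and hi: "?lo (\<tau> @ \<rho>) < ?hi \<tau>"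
      by (simp_all add: field_simps power_add)
    have lohi: "?lo (\<tau> @ \<rho>) < ?hi (\<tau> @ \<rho>)" by (simp add: divide_strict_right_mono)
    assume "i \<noteq> j"
    then consider "i < j" | "j < i" by linarith
    then show False
    proof cases
      case 1
      with that weight_less[of i j] hi show ?thesis unfolding serves_iff by linarith
    next
      case 2
      with that weight_less[of j i] lo lohi show ?thesis unfolding serves_iff by linarith
    qed
  qed
  have ex: "\<exists>\<tau>. serves \<tau> i" if "v i" for i
  proof -
    \<comment> \<open>The left end is rounded up to the grid of width
      \<open>(1/2) ^ Suc (r i)\<close>. The reserved interval is two cells wide, so it contains the
      whole cell that starts at \<open>k\<close>.\<close>
    define k where "k = nat \<lceil>weight i * 2 ^ Suc (r i)\<rceil>"
    have nonneg: "0 \<le> weight i" by (auto simp: weight_def intro: sum_nonneg)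
    then have k: "weight i * 2 ^ Suc (r i) \<le> k" "k < weight i * 2 ^ Suc (r i) + 1"
      unfolding k_def by (simp_all add: of_nat_nat) linarith+
    have "weight i + (1/2) ^ r i \<le> 1"
      using bound[of "Suc i"] that by (simp add: weight_def)
    then have "(weight i + (1/2) ^ r i) * 2 ^ Suc (r i) \<le> 1 * 2 ^ Suc (r i)"
      by (intro mult_right_mono) auto
    then have "weight i * 2 ^ Suc (r i) + 2 \<le> 2 ^ Suc (r i)"
      by (simp add: algebra_simps power_one_over)
    with k have "real k < real (2 ^ Suc (r i))" by simp
    then have "k < 2 ^ Suc (r i)" by (simp only: of_nat_less_iff)
    then obtain \<tau> where \<tau>: "length \<tau> = Suc (r i)" "bin_value \<tau> = k" using bin_value_surj by blast
    have "weight i \<le> k / 2 ^ Suc (r i)" using k by (simp add: field_simps)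
    moreover have "Suc k / 2 ^ Suc (r i) \<le> weight i + (1/2) ^ r i"
    proof -
      have "real (Suc k) \<le> (weight i + (1/2) ^ r i) * 2 ^ Suc (r i)"
        using k by (simp add: algebra_simps power_one_over)
      then show ?thesis by (simp only: pos_divide_le_eq zero_less_power zero_less_numeral)
    qed
    ultimately have "serves \<tau> i" unfolding serves_iff using \<tau> that by simp
    then show ?thesis ..
  qed
  define M where "M \<tau> = (if \<exists>i. serves \<tau> i then Some (out (LEAST i. serves \<tau> i)) else None)" for \<tau>
  have M: "M \<tau> = Some (out i)" if "serves \<tau> i" for \<tau> i
  proof -
    have "(LEAST i. serves \<tau> i) = i"
      using unique[of \<tau> _ "[]"] that by (intro Least_equality) fastforce+
    then show ?thesis using that by (auto simp: M_def)
  qed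
  show ?thesis
  proof (rule that)
    have "computable_in A (\<lambda>w :: nat \<times> nat. serves (str_decode (fst w)) (snd w))"
      unfolding serves_def frac_def
      by (intro computable computable_comp[OF v] computable_comp[OF r])
    moreover have "computable_in A (\<lambda>w :: nat \<times> nat. out (snd w))"
      by (intro computable computable_comp[OF out])
    ultimately have rec: "recursive_in A (\<lambda>x. if \<exists>i. serves (str_decode x) i
        then Some (enc (out (LEAST i. serves (str_decode x) i))) else None)" (is "recursive_in A ?f")
      by (rule recursive_in_search[where p = "\<lambda>w. serves (str_decode (fst w)) (snd w)"
            and q = "\<lambda>w. out (snd w)", unfolded fst_conv snd_conv])
    have "\<forall>\<tau>. ?f (str_code \<tau>) = map_option str_code (M \<tau>)"
      by (simp add: M_def str_code_eq_enc)
    moreover have "prefix_free (dom M)"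
      unfolding prefix_free_def
    proof (intro ballI impI)
      fix \<sigma> \<tau> assume "\<sigma> \<in> dom M" "\<tau> \<in> dom M" "prefix \<sigma> \<tau>"
      then obtain i j \<rho> where ij: "serves \<sigma> i" "serves (\<sigma> @ \<rho>) j" and \<tau>: "\<tau> = \<sigma> @ \<rho>"
        by (auto simp: M_def prefix_def split: if_splits)
      have "length \<sigma> = length (\<sigma> @ \<rho>)"
        using unique[OF ij] ij unfolding serves_def by metis
      then show "\<sigma> = \<tau>" by (simp add: \<tau>)
    qed
    ultimately show "prefix_free_machine A M"
      unfolding prefix_free_machine_def using rec by blast
    fix i assume "v i"
    then obtain \<tau> where "serves \<tau> i" using ex by blast
    then show "\<exists>\<tau>. M \<tau> = Some (out i) \<and> length \<tau> = Suc (r i)"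
      using M serves_iff by blast
  qed
qed

section \<open>Descriptions by an optimal machine\<close>

lemma complexity_le: "U \<tau> = Some \<sigma> \<Longrightarrow> complexity U \<sigma> \<le> length \<tau>"
  unfolding complexity_def by (rule Least_le) blast

text \<open>Passing from the machine built for the requests to \<open>U\<close> costs a constant,
  which also absorbs the extra bit of each description.\<close>

lemma optimal_machine_requests:
  fixes v :: "nat \<Rightarrow> bool" and r :: "nat \<Rightarrow> nat" and out :: "nat \<Rightarrow> bool list"
  assumes U: "optimal_machine A U"
    and "computable_in A v" "computable_in A r" "computable_in A out"
    and "\<And>n. (\<Sum>i<n. if v i then (1/2) ^ r i else 0) \<le> (1::real)"
  obtains c where "\<And>i. v i \<Longrightarrow> \<exists>\<tau>. U \<tau> = Some (out i) \<and> length \<tau> \<le> r i + c"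
proof -
  obtain M where M: "prefix_free_machine A M"
    "\<And>i. v i \<Longrightarrow> \<exists>\<tau>. M \<tau> = Some (out i) \<and> length \<tau> = Suc (r i)"
    using machine_existence[OF assms(2-5)] by blast
  then obtain c where c: "\<And>\<tau> \<sigma>. M \<tau> = Some \<sigma> \<Longrightarrow> \<exists>\<rho>. U \<rho> = Some \<sigma> \<and> length \<rho> \<le> length \<tau> + c"
    using U unfolding optimal_machine_def by blast
  show ?thesis
  proof (rule that[of "Suc c"])
    fix i assume "v i"
    then show "\<exists>\<tau>. U \<tau> = Some (out i) \<and> length \<tau> \<le> r i + Suc c"
      using M(2) c by (metis add_Suc_shift)
  qed
qed

lemma optimal_machine_complexity_attained:
  assumes "optimal_machine A U"
  obtains \<tau> where "U \<tau> = Some \<sigma>" "length \<tau> = complexity U \<sigma>"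
proof -
  \<comment> \<open>A single request of weight 1 is enough to see that \<open>U\<close> outputs
    \<open>\<sigma>\<close>, whence the \<open>LEAST\<close> defining the complexity is
    attained.\<close>
  have "(\<Sum>i<n. if i = 0 then (1/2) ^ (0::nat) else 0) \<le> (1::real)" for n :: nat
    by (subst sum.delta) auto
  then obtain \<tau> where "U \<tau> = Some \<sigma>"
    using optimal_machine_requests[OF assms, of "\<lambda>i. i = 0" "\<lambda>_. 0" "\<lambda>_. \<sigma>"]
      computable_const computable_is_zero[OF computable_id] by metis
  then have "\<exists>k \<tau>. U \<tau> = Some \<sigma> \<and> length \<tau> = k" by blast
  from LeastI_ex[OF this] have "\<exists>\<tau>. U \<tau> = Some \<sigma> \<and> length \<tau> = complexity U \<sigma>"
    unfolding complexity_def .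
  then show ?thesis using that by blast
qed

section \<open>Lebesgue measure on Cantor space\<close>

lemma length_initseg [simp]: "length (X \<restriction>\<^bsub>seq\<^esub> n) = n"
  by (simp add: initseg_def)

lemma initseg_Suc: "X \<restriction>\<^bsub>seq\<^esub> Suc n = X \<restriction>\<^bsub>seq\<^esub> n @ [X n]"
  by (simp add: initseg_def)

lemma take_initseg: "m \<le> n \<Longrightarrow> take m (X \<restriction>\<^bsub>seq\<^esub> n) = X \<restriction>\<^bsub>seq\<^esub> m"
  by (simp add: initseg_def take_map)

lemma cylinder_iff: "X \<in> cylinder \<sigma> \<longleftrightarrow> (\<forall>i<length \<sigma>. X i = \<sigma> ! i)"
  by (simp only: cylinder_def initseg_def list_eq_iff_nth_eq mem_Collect_eq length_map length_upt) simp

lemma cylinder_mono: "prefix \<sigma> \<tau> \<Longrightarrow> cylinder \<tau> \<subseteq> cylinder \<sigma>"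
  by (fastforce simp: cylinder_iff prefix_def nth_append)

lemma initseg_in_cylinder: "X \<in> cylinder \<sigma> \<Longrightarrow> length \<sigma> \<le> n \<Longrightarrow> prefix \<sigma> (X \<restriction>\<^bsub>seq\<^esub> n)"
  unfolding cylinder_def mem_Collect_eq by (metis take_initseg take_is_prefix)

lemma cylinder_disjoint:
  assumes "\<not> prefix \<sigma> \<tau>" "\<not> prefix \<tau> \<sigma>"
  shows "cylinder \<sigma> \<inter> cylinder \<tau> = {}"
proof (rule ccontr)
  assume "cylinder \<sigma> \<inter> cylinder \<tau> \<noteq> {}"
  then obtain X where "X \<in> cylinder \<sigma>" "X \<in> cylinder \<tau>" by blast
  then have "prefix \<sigma> (X \<restriction>\<^bsub>seq\<^esub> max (length \<sigma>) (length \<tau>))" "prefix \<tau> (X \<restriction>\<^bsub>seq\<^esub> max (length \<sigma>) (length \<tau>))"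
    by (auto intro: initseg_in_cylinder)
  then show False using prefix_same_cases assms by blast
qed

interpretation cantor: product_prob_space "\<lambda>_ :: nat. measure_pmf (bernoulli_pmf (1/2))" UNIV
  rewrites "(\<Pi>\<^sub>M i\<in>(UNIV :: nat set). measure_pmf (bernoulli_pmf (1/2))) = cantor_measure"
  by unfold_locales (simp add: cantor_measure_def)

lemma space_cantor_measure [simp]: "space cantor_measure = UNIV"
  by (simp add: cantor_measure_def space_PiM)

text \<open>Fixing finitely many coordinates and leaving the others free is the form to which the
  product formula for the measure applies.\<close>

lemma cylinder_eq_emb:
  "cylinder \<sigma> = prod_emb UNIV (\<lambda>_ :: nat. measure_pmf (bernoulli_pmf (1/2))) {..<length \<sigma>}
    (\<Pi>\<^sub>E i\<in>{..<length \<sigma>}. {\<sigma> ! i})"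
  by (rule set_eqI) (simp add: prod_emb_iff restrict_PiE_iff cylinder_iff extensional_def Ball_def Pi_iff)

lemma sets_cylinder [measurable, simp]: "cylinder \<sigma> \<in> sets cantor_measure"
  unfolding cylinder_eq_emb cantor_measure_def by (rule sets_PiM_I) auto

lemma measure_cylinder: "measure cantor_measure (cylinder \<sigma>) = (1/2) ^ length \<sigma>"
proof -
  have half: "measure (measure_pmf (bernoulli_pmf (1/2))) {b} = 1/2" for b
    by (cases b) (simp_all add: measure_pmf_single)
  have "measure cantor_measure (cylinder \<sigma>) =
      (\<Prod>i\<in>{..<length \<sigma>}. measure (measure_pmf (bernoulli_pmf (1/2))) {\<sigma> ! i})"
    unfolding cylinder_eq_emb by (rule cantor.measure_PiM_emb) auto
  then show ?thesis by (simp add: half)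
qed

lemma sets_cylinder_UN [measurable, simp]: "(\<Union>\<sigma>\<in>D. cylinder (b \<sigma>)) \<in> sets cantor_measure"
  for b :: "bool list \<Rightarrow> bool list"
  by (rule sets.countable_UN') auto

lemma sum_disjoint_cylinders_le:
  assumes "finite F" "disjoint_family_on (\<lambda>x. cylinder (b x)) F" "(\<Union>x\<in>F. cylinder (b x)) \<subseteq> S"
    and "S \<in> sets cantor_measure"
  shows "(\<Sum>x\<in>F. (1/2) ^ length (b x)) \<le> measure cantor_measure S"
proof -
  have "(\<Sum>x\<in>F. (1/2) ^ length (b x)) = (\<Sum>x\<in>F. measure cantor_measure (cylinder (b x)))"
    by (simp add: measure_cylinder)
  also have "\<dots> = measure cantor_measure (\<Union>x\<in>F. cylinder (b x))"
    by (rule cantor.P.finite_measure_finite_Union[symmetric]) (use assms in auto)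
  also have "\<dots> \<le> measure cantor_measure S"
    by (rule cantor.P.finite_measure_mono) (use assms in auto)
  finally show ?thesis .
qed

text \<open>Kraft's inequality for \<open>D\<close> enters through the disjointness of its cylinders.\<close>

lemma measure_prefix_free_image_le:
  assumes "prefix_free D" and len: "\<And>\<tau>. \<tau> \<in> D \<Longrightarrow> length \<tau> + c \<le> length (b \<tau>)"
  shows "measure cantor_measure (\<Union>\<tau>\<in>D. cylinder (b \<tau>)) \<le> (1/2) ^ c"
proof -
  \<comment> \<open>The union is indexed by natural numbers; requiring \<open>i\<close> to be the
    code of the string it decodes to prevents a string from being counted twice.\<close>
  define B where "B i = (if from_nat i \<in> D \<and> to_nat (from_nat i :: bool list) = i then cylinder (b (from_nat i)) else {})" for i
  define C where "C i = (if from_nat i \<in> D \<and> to_nat (from_nat i :: bool list) = i then cylinder (from_nat i) else {})" for i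
  have sets: "B i \<in> sets cantor_measure" "C i \<in> sets cantor_measure" for i
    by (auto simp: B_def C_def)
  have "(\<Union>\<tau>\<in>D. cylinder (b \<tau>)) = (\<Union>i. B i)"
  proof
    show "(\<Union>\<tau>\<in>D. cylinder (b \<tau>)) \<subseteq> (\<Union>i. B i)"
    proof (intro UN_least)
      fix \<tau> assume "\<tau> \<in> D"
      then have "cylinder (b \<tau>) = B (to_nat \<tau>)" by (simp add: B_def)
      then show "cylinder (b \<tau>) \<subseteq> (\<Union>i. B i)" by blast
    qed
  qed (auto simp: B_def split: if_splits)
  then have "emeasure cantor_measure (\<Union>\<tau>\<in>D. cylinder (b \<tau>)) \<le> (\<Sum>i. emeasure cantor_measure (B i))"
    using emeasure_subadditive_countably[of B cantor_measure] sets by auto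
  \<comment> \<open>Each image cylinder has at most the fraction \<open>(1/2) ^ c\<close> of the
    measure of the cylinder of its string, and the latter cylinders are disjoint.\<close>
  also have "\<dots> \<le> (\<Sum>i. ennreal ((1/2) ^ c) * emeasure cantor_measure (C i))"
  proof (intro suminf_le allI)
    fix i
    show "emeasure cantor_measure (B i) \<le> ennreal ((1/2) ^ c) * emeasure cantor_measure (C i)"
    proof (cases "from_nat i \<in> D \<and> to_nat (from_nat i :: bool list) = i")
      case True
      then have "(1/2::real) ^ length (b (from_nat i)) \<le> (1/2) ^ (length (from_nat i :: bool list) + c)"
        by (intro power_decreasing len) auto
      then have "ennreal ((1/2) ^ length (b (from_nat i)))
          \<le> ennreal ((1/2) ^ c * (1/2) ^ length (from_nat i :: bool list))"
        by (intro ennreal_leI) (simp add: power_add mult.commute)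
      also have "\<dots> = ennreal ((1/2) ^ c) * ennreal ((1/2) ^ length (from_nat i :: bool list))"
        by (rule ennreal_mult) auto
      finally show ?thesis
        using True by (simp add: B_def C_def cantor.P.emeasure_eq_measure measure_cylinder)
    next
      case False
      then have "B i = {}" by (auto simp: B_def)
      then show ?thesis by simp
    qed
  qed auto
  also have "\<dots> = ennreal ((1/2) ^ c) * (\<Sum>i. emeasure cantor_measure (C i))"
    by (rule ennreal_suminf_cmult)
  also have "(\<Sum>i. emeasure cantor_measure (C i)) = emeasure cantor_measure (\<Union>i. C i)"
  proof (rule suminf_emeasure)
    show "disjoint_family C"
      unfolding disjoint_family_on_def
    proof (intro ballI impI)
      fix i j :: nat assume "i \<noteq> j"
      let ?\<sigma> = "from_nat i :: bool list" and ?\<tau> = "from_nat j :: bool list"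
      show "C i \<inter> C j = {}"
      proof (cases "?\<sigma> \<in> D \<and> to_nat ?\<sigma> = i \<and> ?\<tau> \<in> D \<and> to_nat ?\<tau> = j")
        case True
        then have "?\<sigma> \<noteq> ?\<tau>" using \<open>i \<noteq> j\<close> by metis
        then have "\<not> prefix ?\<sigma> ?\<tau>" "\<not> prefix ?\<tau> ?\<sigma>"
          using True assms(1) unfolding prefix_free_def by metis+
        then show ?thesis using cylinder_disjoint by (auto simp: C_def)
      qed (auto simp: C_def)
    qed
  qed (use sets in auto)
  also have "ennreal ((1/2) ^ c) * emeasure cantor_measure (\<Union>i. C i) \<le> ennreal ((1/2) ^ c) * 1"
    by (intro mult_left_mono cantor.P.measure_le_1) auto
  finally show ?thesis
    by (simp add: cantor.P.emeasure_eq_measure)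
qed

section \<open>Random sequences in every cylinder\<close>

text \<open>Syntax for the rules of \<open>recursive_in\<close>; its countability carries over to
  the relativised partial recursive functions, and so to the tests.\<close>

datatype program = Zero | Succ | Fst | Snd | Oracle | Pair program program
  | Compose program program | Rec program program | Search program

primrec run_program :: "nat set \<Rightarrow> program \<Rightarrow> nat \<Rightarrow> nat option" where
  "run_program A Zero = (\<lambda>_. Some 0)"
| "run_program A Succ = (\<lambda>x. Some (Suc x))"
| "run_program A Fst = (\<lambda>x. Some (fst (prod_decode x)))"
| "run_program A Snd = (\<lambda>x. Some (snd (prod_decode x)))"
| "run_program A Oracle = (\<lambda>x. Some (of_bool (x \<in> A)))"
| "run_program A (Pair p q) = (\<lambda>x. Option.bind (run_program A p x) (\<lambda>y.
    Option.bind (run_program A q x) (\<lambda>z. Some (prod_encode (y, z)))))"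
| "run_program A (Compose p q) = (\<lambda>x. Option.bind (run_program A q x) (run_program A p))"
| "run_program A (Rec p q) = (\<lambda>x. case prod_decode x of (a, n) \<Rightarrow> rec_nat (run_program A p a)
    (\<lambda>y r. Option.bind r (\<lambda>i. run_program A q (prod_encode (a, prod_encode (y, i))))) n)"
| "run_program A (Search p) = (\<lambda>a. minimize (\<lambda>n. run_program A p (prod_encode (a, n))))"

instance program :: countable
  by countable_datatype

lemma countable_recursive_in: "countable {f. recursive_in A f}"
proof (rule countable_subset)
  show "{f. recursive_in A f} \<subseteq> range (run_program A)"
  proof (intro subsetI, elim CollectE)
    fix f assume "recursive_in A f"
    then show "f \<in> range (run_program A)"
    proof induction
      case zero then show ?case by (intro range_eqI[of _ _ Zero]) simp
    next
      case succ then show ?case by (intro range_eqI[of _ _ Succ]) simp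
    next
      case left then show ?case by (intro range_eqI[of _ _ Fst]) simp
    next
      case right then show ?case by (intro range_eqI[of _ _ Snd]) simp
    next
      case orac then show ?case by (intro range_eqI[of _ _ Oracle]) simp
    next
      case (pair f g)
      then obtain p q where "f = run_program A p" "g = run_program A q" by blast
      then show ?case by (intro range_eqI[of _ _ "Pair p q"]) simp
    next
      case (comp f g)
      then obtain p q where "f = run_program A p" "g = run_program A q" by blast
      then show ?case by (intro range_eqI[of _ _ "Compose p q"]) simp
    next
      case (prec f g)
      then obtain p q where "f = run_program A p" "g = run_program A q" by blast
      then show ?case by (intro range_eqI[of _ _ "Rec p q"]) simp
    next
      case (mu f)
      then obtain p where "f = run_program A p" by blast
      then show ?case by (intro range_eqI[of _ _ "Search p"]) simp
    qed
  qed
qed auto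

text \<open>Every test captures a null set and there are countably many tests, whereas the cylinder
  has positive measure.\<close>

lemma MLR_meets_cylinder: "\<exists>X. X \<in> MLR A \<and> X \<in> cylinder \<rho>"
proof -
  \<comment> \<open>Tests are indexed by functions whose domains enumerate them, which makes the
    index set countable.\<close>
  define V where "V f n = {\<sigma>. prod_encode (n, str_code \<sigma>) \<in> dom f}" for f :: "nat \<Rightarrow> nat option" and n
  define N where "N f = (\<Inter>n. \<Union>\<sigma>\<in>V f n. cylinder \<sigma>)" for f
  define Fs where "Fs = {f. recursive_in A f \<and> MartinLoef_test A (V f)}"
  have "N f \<in> null_sets cantor_measure" if "f \<in> Fs" for f
  proof (rule null_setsI)
    show sets: "N f \<in> sets cantor_measure"
      unfolding N_def using sets_cylinder_UN[of "\<lambda>\<sigma>. \<sigma>"] sets.top[of cantor_measure]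
      by (intro sets.countable_INT'') auto
    have "measure cantor_measure (N f) \<le> (1/2) ^ n" for n
    proof -
      have "measure cantor_measure (N f) \<le> measure cantor_measure (\<Union>\<sigma>\<in>V f n. cylinder \<sigma>)"
        using sets_cylinder_UN[of "\<lambda>\<sigma>. \<sigma>"] by (intro cantor.P.finite_measure_mono) (auto simp: N_def)
      also have "\<dots> \<le> (1/2) ^ n" using that by (simp add: Fs_def MartinLoef_test_def)
      finally show ?thesis .
    qed
    moreover have "(\<lambda>n. (1/2::real) ^ n) \<longlonglongrightarrow> 0" by (rule LIMSEQ_power_zero) simp
    ultimately have "measure cantor_measure (N f) \<le> 0" by (intro LIMSEQ_le_const) auto
    then show "emeasure cantor_measure (N f) = 0"
      by (simp add: cantor.P.emeasure_eq_measure measure_le_0_iff)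
  qed
  moreover have "countable Fs"
    using countable_recursive_in[of A] by (rule countable_subset[rotated]) (auto simp: Fs_def)
  ultimately have null: "(\<Union>f\<in>Fs. N f) \<in> null_sets cantor_measure" by (intro null_sets_UN') auto
  have MLR: "X \<in> MLR A" if "X \<notin> (\<Union>f\<in>Fs. N f)" for X
    unfolding MLR_def
  proof (intro CollectI allI impI)
    fix W assume W: "MartinLoef_test A W"
    then obtain f where f: "recursive_in A f" "{prod_encode (n, str_code \<sigma>) | n \<sigma>. \<sigma> \<in> W n} = dom f"
      by (auto simp: MartinLoef_test_def ce_in_def)
    have "V f = W"
      unfolding V_def f(2)[symmetric] by (auto simp: fun_eq_iff str_code_eq_enc)
    with W f(1) have "f \<in> Fs" by (simp add: Fs_def)
    with that show "X \<notin> (\<Inter>n. \<Union>\<sigma>\<in>W n. cylinder \<sigma>)" unfolding \<open>V f = W\<close>[symmetric] N_def by blast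
  qed
  have "\<not> cylinder \<rho> \<subseteq> (\<Union>f\<in>Fs. N f)"
  proof
    assume "cylinder \<rho> \<subseteq> (\<Union>f\<in>Fs. N f)"
    then have "cylinder \<rho> \<in> null_sets cantor_measure"
      using null_sets_subset[OF null] by simp
    then have "measure cantor_measure (cylinder \<rho>) = 0" by (simp add: null_sets_def measure_def)
    then show False by (simp add: measure_cylinder)
  qed
  then show ?thesis using MLR by blast
qed

section \<open>Branching bits along a path\<close>

definition branch_bits :: "(nat \<Rightarrow> bool) set \<Rightarrow> bool list \<Rightarrow> bool list" where
  "branch_bits P \<sigma> = map ((!) \<sigma>) (filter (\<lambda>j. branching P (take j \<sigma>)) [0..<length \<sigma>])"

lemma branch_bits_Nil [simp]: "branch_bits P [] = []"
  by (simp add: branch_bits_def)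

lemma branch_bits_snoc:
  "branch_bits P (\<sigma> @ [b]) = branch_bits P \<sigma> @ (if branching P \<sigma> then [b] else [])"
proof -
  have "filter (\<lambda>j. branching P (take j (\<sigma> @ [b]))) [0..<length \<sigma>] = filter (\<lambda>j. branching P (take j \<sigma>)) [0..<length \<sigma>]"
    by (rule filter_cong) auto
  then show ?thesis by (auto simp: branch_bits_def nth_append)
qed

lemma length_branch_bits: "length (branch_bits P \<sigma>) = card {j. j < length \<sigma> \<and> branching P (take j \<sigma>)}"
proof -
  have "length (branch_bits P \<sigma>) = length (filter (\<lambda>j. branching P (take j \<sigma>)) [0..<length \<sigma>])"
    by (simp add: branch_bits_def)
  also have "\<dots> = card (set (filter (\<lambda>j. branching P (take j \<sigma>)) [0..<length \<sigma>]))"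
    by (rule distinct_card[symmetric]) simp
  also have "set (filter (\<lambda>j. branching P (take j \<sigma>)) [0..<length \<sigma>]) = {j. j < length \<sigma> \<and> branching P (take j \<sigma>)}"
    by auto
  finally show ?thesis .
qed

lemma branch_bits_mono: "prefix \<sigma> \<tau> \<Longrightarrow> prefix (branch_bits P \<sigma>) (branch_bits P \<tau>)"
proof (induction \<tau> rule: rev_induct)
  case (snoc b \<tau>)
  then show ?case by (auto simp: prefix_snoc branch_bits_snoc intro: prefix_order.trans[OF _ prefixI])
qed simp

lemma extendible_prefix: "\<tau> \<in> extendible P \<Longrightarrow> prefix \<sigma> \<tau> \<Longrightarrow> \<sigma> \<in> extendible P"
  unfolding extendible_def using cylinder_mono by blast

lemma initseg_extendible: "X \<in> P \<Longrightarrow> X \<restriction>\<^bsub>seq\<^esub> n \<in> extendible P"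
  by (auto simp: extendible_def cylinder_def)

text \<open>For a nonempty string in the tree, the sibling is extendible exactly when the parent
  branches; so each counted length corresponds to one branching node passed.\<close>

lemma theta_eq_length_branch_bits:
  "\<sigma> \<in> extendible P \<Longrightarrow> theta P \<sigma> = length (branch_bits P \<sigma>)"
proof (induction \<sigma> rule: rev_induct)
  case Nil
  then show ?case by (simp add: theta_def)
next
  case (snoc b \<sigma>)
  let ?S = "\<lambda>\<sigma>. {n. 1 \<le> n \<and> n \<le> length \<sigma> \<and> flip_last (take n \<sigma>) \<in> extendible P}"
  have "\<sigma> \<in> extendible P" using snoc.prems by (rule extendible_prefix) simp
  then have IH: "card (?S \<sigma>) = length (branch_bits P \<sigma>)" using snoc.IH by (simp add: theta_def)
  have br: "branching P \<sigma> \<longleftrightarrow> flip_last (\<sigma> @ [b]) \<in> extendible P"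
    using snoc.prems by (cases b) (auto simp: branching_def flip_last_def)
  have "?S (\<sigma> @ [b]) = ?S \<sigma> \<union> (if branching P \<sigma> then {Suc (length \<sigma>)} else {})"
    by (auto simp: br le_Suc_eq)
  moreover have "finite (?S \<sigma>)" by (rule finite_subset[of _ "{..length \<sigma>}"]) auto
  ultimately have "card (?S (\<sigma> @ [b])) = card (?S \<sigma>) + (if branching P \<sigma> then 1 else 0)"
    by simp
  then show ?case unfolding theta_def branch_bits_snoc IH by simp
qed

text \<open>Where the two strings part, at \<open>\<rho>\<close>, both children are extendible.
  Hence \<open>\<rho>\<close> branches, and the differing bits are recorded at the same
  position.\<close>

lemma branch_bits_disjoint:
  assumes "\<sigma> \<in> extendible P" "\<tau> \<in> extendible P" "\<not> prefix \<sigma> \<tau>" "\<not> prefix \<tau> \<sigma>"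
  shows "cylinder (branch_bits P \<sigma>) \<inter> cylinder (branch_bits P \<tau>) = {}"
proof -
  have "\<sigma> \<parallel> \<tau>" using assms(3,4) by blast
  from parallel_decomp[OF this] obtain \<rho> a \<sigma>' b \<tau>' where ab: "a \<noteq> b" and \<sigma>: "\<sigma> = \<rho> @ a # \<sigma>'" and \<tau>: "\<tau> = \<rho> @ b # \<tau>'"
    by blast
  have pre: "prefix (\<rho> @ [a]) \<sigma>" "prefix (\<rho> @ [b]) \<tau>" by (auto simp: \<sigma> \<tau> prefix_def)
  then have "\<rho> @ [a] \<in> extendible P" "\<rho> @ [b] \<in> extendible P"
    using assms(1,2) extendible_prefix by blast+
  with ab have "branching P \<rho>" by (cases a; cases b) (auto simp: branching_def)
  with pre[THEN branch_bits_mono[of _ _ P]]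
  have "prefix (branch_bits P \<rho> @ [a]) (branch_bits P \<sigma>)" "prefix (branch_bits P \<rho> @ [b]) (branch_bits P \<tau>)"
    by (simp_all add: branch_bits_snoc)
  then have "cylinder (branch_bits P \<sigma>) \<subseteq> cylinder (branch_bits P \<rho> @ [a])"
    "cylinder (branch_bits P \<tau>) \<subseteq> cylinder (branch_bits P \<rho> @ [b])"
    by (auto dest: cylinder_mono)
  moreover have "cylinder (branch_bits P \<rho> @ [a]) \<inter> cylinder (branch_bits P \<rho> @ [b]) = {}"
    using ab by (intro cylinder_disjoint) auto
  ultimately show ?thesis by blast
qed

section \<open>The path produced from a given source\<close>

lemma Psi_str_Suc: "Psi_str P R (Suc m) = Psi_str P R m @ [Psi P R m]"
  by (simp add: Psi_def Let_def)

lemma Psi_str_eq_initseg: "Psi_str P R n = Psi P R \<restriction>\<^bsub>seq\<^esub> n"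
  by (induction n) (simp_all only: Psi_str_Suc initseg_Suc, simp_all add: initseg_def)

lemma Psi_eq:
  "Psi P R m = (if branching P (Psi P R \<restriction>\<^bsub>seq\<^esub> m) then R (length (branch_bits P (Psi P R \<restriction>\<^bsub>seq\<^esub> m)))
    else (THE i. Psi P R \<restriction>\<^bsub>seq\<^esub> m @ [i] \<in> extendible P))"
proof -
  have "Psi P R m = (if branching P (Psi_str P R m)
      then R (card {j. j < m \<and> branching P (take j (Psi_str P R m))})
      else (THE i. Psi_str P R m @ [i] \<in> extendible P))"
    by (simp add: Psi_def Let_def)
  then show ?thesis unfolding Psi_str_eq_initseg by (simp add: length_branch_bits)
qed

lemma cylinder_snoc_iff: "X \<in> cylinder (\<sigma> @ [b]) \<longleftrightarrow> X \<in> cylinder \<sigma> \<and> X (length \<sigma>) = b"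
  by (auto simp: cylinder_iff nth_append less_Suc_eq)

lemma in_cylinder_branch_bits_Psi: "R \<in> cylinder (branch_bits P (Psi P R \<restriction>\<^bsub>seq\<^esub> n))"
proof (induction n)
  case 0
  then show ?case by (simp add: initseg_def cylinder_iff)
next
  case (Suc n)
  then show ?case
    by (auto simp: initseg_Suc branch_bits_snoc cylinder_snoc_iff Psi_eq[of P R n])
qed

text \<open>By induction both sequences make the same choice: at a branching node it is dictated by
  \<open>R\<close>, elsewhere only one extension stays in the tree.\<close>

lemma Psi_eq_if_in_cylinders:
  assumes X: "X \<in> P" and R: "\<And>n. R \<in> cylinder (branch_bits P (X \<restriction>\<^bsub>seq\<^esub> n))"
  shows "Psi P R = X"
proof -
  have "Psi P R \<restriction>\<^bsub>seq\<^esub> n = X \<restriction>\<^bsub>seq\<^esub> n" for n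
  proof (induction n)
    case (Suc n)
    have "Psi P R n = X n"
    proof (cases "branching P (X \<restriction>\<^bsub>seq\<^esub> n)")
      case True
      then have "R (length (branch_bits P (X \<restriction>\<^bsub>seq\<^esub> n))) = X n"
        using R[of "Suc n"] by (simp add: initseg_Suc branch_bits_snoc cylinder_snoc_iff)
      then show ?thesis using Psi_eq[of P R n] True by (simp add: Suc)
    next
      case False
      have "X \<restriction>\<^bsub>seq\<^esub> n @ [X n] \<in> extendible P"
        using initseg_extendible[OF X, of "Suc n"] by (simp add: initseg_Suc)
      then have "(THE i. X \<restriction>\<^bsub>seq\<^esub> n @ [i] \<in> extendible P) = X n"
        using False unfolding branching_def by (intro the_equality) (metis (full_types))+
      then show ?thesis
        using Psi_eq[of P R n] False by (simp add: Suc)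
    qed
    then show ?case by (simp add: initseg_Suc Suc)
  qed (simp add: initseg_def)
  then have "Psi P R \<restriction>\<^bsub>seq\<^esub> Suc n = X \<restriction>\<^bsub>seq\<^esub> Suc n" for n .
  then show ?thesis by (simp add: fun_eq_iff initseg_Suc)
qed

lemma randomly_produced_iff:
  assumes "X \<in> P"
  shows "X \<in> randomly_produced_paths P \<longleftrightarrow>
    (\<exists>R \<in> MLR (tree_oracle P). \<forall>n. R \<in> cylinder (branch_bits P (X \<restriction>\<^bsub>seq\<^esub> n)))"
proof
  assume "X \<in> randomly_produced_paths P"
  then obtain R where "R \<in> MLR (tree_oracle P)" "X = Psi P R"
    by (auto simp: randomly_produced_paths_def)
  then show "\<exists>R \<in> MLR (tree_oracle P). \<forall>n. R \<in> cylinder (branch_bits P (X \<restriction>\<^bsub>seq\<^esub> n))"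
    using in_cylinder_branch_bits_Psi by blast
next
  assume "\<exists>R \<in> MLR (tree_oracle P). \<forall>n. R \<in> cylinder (branch_bits P (X \<restriction>\<^bsub>seq\<^esub> n))"
  then obtain R where "R \<in> MLR (tree_oracle P)" "\<And>n. R \<in> cylinder (branch_bits P (X \<restriction>\<^bsub>seq\<^esub> n))" by blast
  with Psi_eq_if_in_cylinders[OF assms] show "X \<in> randomly_produced_paths P"
    unfolding randomly_produced_paths_def by blast
qed

section \<open>Computing branching bits with the tree as oracle\<close>

lemma computable_extendible [computable]:
  assumes "computable_in (tree_oracle P) f"
  shows "computable_in (tree_oracle P) (\<lambda>x. f x \<in> extendible P)"
proof -
  have "computable_in (tree_oracle P) (\<lambda>x. enc (f x) \<in> tree_oracle P)" by (intro computable assms)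
  moreover have "enc \<sigma> \<in> tree_oracle P \<longleftrightarrow> \<sigma> \<in> extendible P" for \<sigma>
    by (auto simp: tree_oracle_def str_code_eq_enc)
  ultimately show ?thesis by simp
qed

lemma mem_tree_oracleD:
  assumes "k \<in> tree_oracle P" shows "enc (str_decode k) = k" "str_decode k \<in> extendible P"
  using assms by (auto simp: tree_oracle_def str_code_eq_enc)

lemma computable_branch_bits [computable]:
  assumes "computable_in (tree_oracle P) f"
  shows "computable_in (tree_oracle P) (\<lambda>x. branch_bits P (f x))"
proof -
  \<comment> \<open>The fold also carries the part of the string read so far, since the oracle has
    to be asked about the children of that node.\<close>
  define step where "step p b = (fst p @ [b], if branching P (fst p) then snd p @ [b] else snd p)" for p b
  have "foldl step ([], []) \<sigma> = (\<sigma>, branch_bits P \<sigma>)" for \<sigma>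
    by (induction \<sigma> rule: rev_induct) (simp_all add: step_def branch_bits_snoc)
  moreover have "computable_in (tree_oracle P) (\<lambda>x. snd (foldl (\<lambda>p b. step p b) ([], []) (f x)))"
    unfolding step_def branching_def by (intro computable assms)
  ultimately show ?thesis by simp
qed

lemma computable_take [computable]:
  assumes "computable_in A n" "computable_in A f" shows "computable_in A (\<lambda>x. take (n x) (f x))"
proof -
  have "computable_in A (\<lambda>x. foldl (\<lambda>a y. if length a < n x then a @ [y] else a) [] (f x))"
    by (intro computable computable_comp[OF assms(1)] assms)
  moreover have "foldl (\<lambda>a y. if length a < k then a @ [y] else a) [] xs = take k xs" for k and xs :: "'b list"
    by (induction xs rule: rev_induct) auto
  ultimately show ?thesis by simp
qed

section \<open>Random sources give incompressible paths\<close>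

lemma compressed_branch_bits_test:
  assumes U: "prefix_free_machine (tree_oracle P) U"
  shows "MartinLoef_test (tree_oracle P)
    (\<lambda>c. {branch_bits P \<sigma> | \<sigma> \<tau>. U \<tau> = Some \<sigma> \<and> \<sigma> \<in> extendible P \<and> length \<tau> + c \<le> length (branch_bits P \<sigma>)})"
    (is "MartinLoef_test ?A ?V")
  unfolding MartinLoef_test_def
proof
  obtain f where f: "recursive_in ?A f" "\<And>\<tau>. f (enc \<tau>) = map_option enc (U \<tau>)"
    using U unfolding prefix_free_machine_def str_code_eq_enc by blast
  obtain g where g: "computable_in ?A g" "approximates g f" by (rule stage_approximation[OF f(1)])
  \<comment> \<open>An index \<open>z\<close> codes a level \<open>c z\<close>, a candidate
    description \<open>\<tau> z\<close> and a stage up to which \<open>U\<close> is run on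
    it.\<close>
  define c where "c z = fst (prod_decode z)" for z
  define \<tau> where "\<tau> z = str_decode (fst (prod_decode (snd (prod_decode z))))" for z
  define k where "k z = g (enc (\<tau> z), snd (prod_decode (snd (prod_decode z))))" for z
  define p where "p z = (case k z of None \<Rightarrow> False | Some y \<Rightarrow>
      y \<in> ?A \<and> length (\<tau> z) + c z \<le> length (branch_bits P (str_decode y)))" for z
  \<comment> \<open>The default \<open>[]\<close> is reached only where \<open>p z\<close> fails,
    since \<open>p z\<close> demands that \<open>k z\<close> has a value.\<close>
  define q where "q z = (c z, branch_bits P (case k z of None \<Rightarrow> [] | Some y \<Rightarrow> str_decode y))" for z
  have "computable_in ?A p" "computable_in ?A q"
    unfolding p_def q_def k_def \<tau>_def c_def by (intro computable computable_comp[OF g(1)])+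
  then have "ce_in ?A {enc (q z) | z. p z}" by (rule ce_in_range)
  also have "{enc (q z) | z. p z} = {prod_encode (n, str_code \<sigma>) | n \<sigma>. \<sigma> \<in> ?V n}"
  proof (intro set_eqI iffI)
    fix x assume "x \<in> {enc (q z) | z. p z}"
    then obtain z where x: "x = enc (q z)" and "p z" by blast
    then obtain y where y: "k z = Some y" "y \<in> ?A" "length (\<tau> z) + c z \<le> length (branch_bits P (str_decode y))"
      unfolding p_def by (auto split: option.splits)
    have "f (enc (\<tau> z)) = Some y"
      using y(1) approximates_iff[OF g(2)] unfolding k_def by blast
    then obtain \<sigma> where \<sigma>: "U (\<tau> z) = Some \<sigma>" "y = enc \<sigma>" by (auto simp: f(2))
    then have "\<sigma> \<in> extendible P" using mem_tree_oracleD(2)[OF y(2)] by simp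
    then have "branch_bits P \<sigma> \<in> ?V (c z)" using y \<sigma> by auto
    moreover have "x = prod_encode (c z, str_code (branch_bits P \<sigma>))"
      using x y(1) \<sigma> by (simp add: q_def str_code_eq_enc)
    ultimately show "x \<in> {prod_encode (n, str_code \<sigma>) | n \<sigma>. \<sigma> \<in> ?V n}" by blast
  next
    fix x assume "x \<in> {prod_encode (n, str_code \<sigma>) | n \<sigma>. \<sigma> \<in> ?V n}"
    then obtain n \<sigma> \<upsilon> where x: "x = prod_encode (n, enc (branch_bits P \<sigma>))" and "U \<upsilon> = Some \<sigma>"
      and \<sigma>: "\<sigma> \<in> extendible P" "length \<upsilon> + n \<le> length (branch_bits P \<sigma>)"
      by (auto simp: str_code_eq_enc)
    then have "f (enc \<upsilon>) = Some (enc \<sigma>)" by (simp add: f(2))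
    then obtain s where s: "g (enc \<upsilon>, s) = Some (enc \<sigma>)" using approximates_iff[OF g(2)] by blast
    define z where "z = prod_encode (n, prod_encode (enc \<upsilon>, s))"
    have "k z = Some (enc \<sigma>)" "c z = n" "\<tau> z = \<upsilon>"
      by (simp_all add: k_def c_def \<tau>_def z_def s)
    then have "p z" "x = enc (q z)"
      using \<sigma> by (auto simp: p_def q_def x tree_oracle_def str_code_eq_enc)
    then show "x \<in> {enc (q z) | z. p z}" by blast
  qed
  finally show "ce_in ?A {prod_encode (n, str_code \<sigma>) | n \<sigma>. \<sigma> \<in> ?V n}" .
  show "\<forall>n. measure cantor_measure (\<Union>\<sigma>\<in>?V n. cylinder \<sigma>) \<le> (1/2) ^ n"
  proof
    fix n
    \<comment> \<open>The union is taken over descriptions instead of strings, because it is the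
      domain of \<open>U\<close> that is prefix-free.\<close>
    define D where "D = {\<tau> \<in> dom U. the (U \<tau>) \<in> extendible P \<and> length \<tau> + n \<le> length (branch_bits P (the (U \<tau>)))}"
    have "prefix_free D" using U unfolding prefix_free_machine_def prefix_free_def D_def by blast
    then have "measure cantor_measure (\<Union>\<tau>\<in>D. cylinder (branch_bits P (the (U \<tau>)))) \<le> (1/2) ^ n"
      by (rule measure_prefix_free_image_le) (simp add: D_def)
    moreover have "(\<Union>\<sigma>\<in>?V n. cylinder \<sigma>) = (\<Union>\<tau>\<in>D. cylinder (branch_bits P (the (U \<tau>))))"
      unfolding D_def by fastforce
    ultimately show "measure cantor_measure (\<Union>\<sigma>\<in>?V n. cylinder \<sigma>) \<le> (1/2) ^ n" by simp
  qed
qed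

section \<open>Incompressible paths come from random sources\<close>

text \<open>Component \<open>2 * n + 1\<close> of the test pays for saving \<open>n\<close> bits:
  level \<open>n\<close> has weight at most
  \<open>2 ^ n * (1/2) ^ (2 * n + 1) = (1/2) ^ Suc n\<close>, and these weights sum to at most
  1.\<close>

lemma compressible_if_not_random:
  assumes U: "optimal_machine (tree_oracle P) U" and X: "X \<in> P"
    and R: "\<And>n. R \<in> cylinder (branch_bits P (X \<restriction>\<^bsub>seq\<^esub> n))"
    and unbounded: "\<And>l. \<exists>n. l \<le> length (branch_bits P (X \<restriction>\<^bsub>seq\<^esub> n))"
    and not_random: "R \<notin> MLR (tree_oracle P)"
  shows "\<exists>c. \<forall>n. \<exists>m. complexity U (X \<restriction>\<^bsub>seq\<^esub> m) + n \<le> length (branch_bits P (X \<restriction>\<^bsub>seq\<^esub> m)) + c"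
proof -
  let ?A = "tree_oracle P"
  obtain V where V: "MartinLoef_test ?A V" and RV: "\<And>n. \<exists>\<rho>\<in>V n. R \<in> cylinder \<rho>"
    using not_random by (auto simp: MLR_def)
  have "ce_in ?A (enc ` {(n, \<sigma>). \<sigma> \<in> V n})"
  proof -
    have "enc ` {(n, \<sigma>). \<sigma> \<in> V n} = {prod_encode (n, str_code \<sigma>) | n \<sigma>. \<sigma> \<in> V n}"
      by (force simp: str_code_eq_enc)
    then show ?thesis using V by (simp add: MartinLoef_test_def)
  qed
  from ce_in_stages[OF this] obtain p :: "(nat \<times> bool list) \<times> nat \<Rightarrow> bool"
    where p: "computable_in ?A p" and mono: "\<forall>x s t. p (x, s) \<longrightarrow> s \<le> t \<longrightarrow> p (x, t)"
      and stages: "\<forall>x. x \<in> {(n, \<sigma>). \<sigma> \<in> V n} \<longleftrightarrow> (\<exists>s. p (x, s))"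
    by (elim exE conjE)
  have p_mono: "p (x, t)" if "p (x, s)" "s \<le> t" for x s t
    using mono that by blast
  have p_iff: "\<rho> \<in> V n \<longleftrightarrow> (\<exists>s. p ((n, \<rho>), s))" for n \<rho>
    using stages[rule_format, of "(n, \<rho>)"] by simp
  \<comment> \<open>Taking the length of \<open>\<sigma>\<close> as the stage makes this decidable;
    it persists under extension because the stage grows and the branching bits are only
    extended.\<close>
  define covered where "covered n \<sigma> \<longleftrightarrow>
    (\<exists>j<Suc (length (branch_bits P \<sigma>)). p ((n, take j (branch_bits P \<sigma>)), length \<sigma>))" for n \<sigma>
  \<comment> \<open>The guard \<open>\<sigma> \<noteq> []\<close> is there because
    \<open>butlast [] = []\<close>: without it a covered empty string would exclude itself.\<close>
  define minimal where "minimal n \<sigma> \<longleftrightarrow>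
    \<sigma> \<in> extendible P \<and> covered n \<sigma> \<and> \<not> (\<sigma> \<noteq> [] \<and> covered n (butlast \<sigma>))" for n \<sigma>
  have covered_mono: "covered n \<tau>" if cov: "covered n \<sigma>" and pre: "prefix \<sigma> \<tau>" for n \<sigma> \<tau>
  proof -
    obtain j where j: "j \<le> length (branch_bits P \<sigma>)" "p ((n, take j (branch_bits P \<sigma>)), length \<sigma>)"
      using cov by (auto simp: covered_def less_Suc_eq_le)
    obtain \<rho> where "branch_bits P \<tau> = branch_bits P \<sigma> @ \<rho>"
      using branch_bits_mono[OF pre, of P] by (auto simp: prefix_def)
    with j p_mono[OF j(2) prefix_length_le[OF pre]] show ?thesis
      unfolding covered_def by (intro exI[of _ j]) auto
  qed
  have minimal_eq: "\<sigma> = \<tau>" if min: "minimal n \<sigma>" "minimal n \<tau>" and pre: "prefix \<sigma> \<tau>" for n \<sigma> \<tau>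
  proof (rule ccontr)
    assume "\<sigma> \<noteq> \<tau>"
    then obtain \<rho> b where "\<tau> = \<sigma> @ \<rho> @ [b]"
      using pre by (metis prefixE append_Nil2 rev_exhaust)
    then have "prefix \<sigma> (butlast \<tau>)" "\<tau> \<noteq> []" by (simp_all add: butlast_append)
    then show False using covered_mono[of n \<sigma>] min unfolding minimal_def by blast
  qed
  have minimal_subset: "cylinder (branch_bits P \<sigma>) \<subseteq> (\<Union>\<rho>\<in>V n. cylinder \<rho>)" if min: "minimal n \<sigma>" for n \<sigma>
  proof -
    obtain j where "p ((n, take j (branch_bits P \<sigma>)), length \<sigma>)"
      using min unfolding minimal_def covered_def by blast
    then have "take j (branch_bits P \<sigma>) \<in> V n" using p_iff by blast
    then show ?thesis using cylinder_mono[OF take_is_prefix[of j "branch_bits P \<sigma>"]] by blast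
  qed
  have measure_V: "measure cantor_measure (\<Union>\<rho>\<in>V n. cylinder \<rho>) \<le> (1/2) ^ n" for n
    using V by (simp add: MartinLoef_test_def)
  have sets_V: "(\<Union>\<rho>\<in>V n. cylinder \<rho>) \<in> sets cantor_measure" for n
    using sets_cylinder_UN[of "\<lambda>\<rho>. \<rho>"] .
  \<comment> \<open>One cylinder cannot be larger than the component containing it. This bound later
    makes the natural number subtraction in \<open>r\<close> exact.\<close>
  have minimal_length: "n \<le> length (branch_bits P \<sigma>)" if "minimal n \<sigma>" for n \<sigma>
  proof -
    have "(1/2::real) ^ length (branch_bits P \<sigma>) \<le> measure cantor_measure (\<Union>\<rho>\<in>V n. cylinder \<rho>)"
      unfolding measure_cylinder[symmetric]
      by (rule cantor.P.finite_measure_mono[OF minimal_subset[OF that] sets_V])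
    also note measure_V
    finally show ?thesis by (simp add: power_decreasing_iff)
  qed
  define N where "N i = fst (prod_decode i)" for i
  define out where "out i = str_decode (snd (prod_decode i))" for i
  \<comment> \<open>Demanding that the second component lies in the oracle restricts it to proper
    codes, so \<open>i\<close> is determined by \<open>N i\<close> and \<open>out i\<close> and no
    string is requested twice at the same level.\<close>
  define v where "v i \<longleftrightarrow> snd (prod_decode i) \<in> ?A \<and> minimal (2 * N i + 1) (out i)" for i
  define r where "r i = length (branch_bits P (out i)) - N i" for i
  have comp: "computable_in ?A v" "computable_in ?A r" "computable_in ?A out"
    unfolding v_def r_def out_def N_def minimal_def covered_def
    by (intro computable computable_comp[OF p])+
  have N_le: "N i \<le> length (branch_bits P (out i))" if "v i" for i
    using that minimal_length[of "2 * N i + 1" "out i"] by (simp add: v_def)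
  have disjoint: "disjoint_family_on (\<lambda>i. cylinder (branch_bits P (out i))) {i \<in> F. v i \<and> N i = n}" for F n
    unfolding disjoint_family_on_def
  proof (intro ballI impI)
    fix i j assume i: "i \<in> {i \<in> F. v i \<and> N i = n}" and j: "j \<in> {i \<in> F. v i \<and> N i = n}" and "i \<noteq> j"
    have "i = prod_encode (N i, enc (out i))" if "v i" for i
    proof -
      have "enc (out i) = snd (prod_decode i)"
        using that mem_tree_oracleD(1) unfolding v_def out_def by blast
      then show ?thesis by (simp add: N_def)
    qed
    from this[of i] this[of j] \<open>i \<noteq> j\<close> i j have "out i \<noteq> out j" by auto
    moreover have "minimal (2 * n + 1) (out i)" "minimal (2 * n + 1) (out j)"
      using i j by (auto simp: v_def)
    ultimately show "cylinder (branch_bits P (out i)) \<inter> cylinder (branch_bits P (out j)) = {}"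
      using minimal_eq[of "2 * n + 1"] unfolding minimal_def by (intro branch_bits_disjoint) metis+
  qed
  have weight: "(\<Sum>i<m. if v i then (1/2) ^ r i else 0) \<le> (1::real)" for m
  proof -
    let ?F = "{i \<in> {..<m}. v i}"
    have "(\<Sum>i<m. if v i then (1/2) ^ r i else 0) = (\<Sum>i\<in>?F. (1/2::real) ^ r i)"
      by (rule sum.inter_filter[symmetric]) simp
    \<comment> \<open>Requests are grouped by the saving \<open>N i\<close>; as
      \<open>N i \<le> i < m\<close>, the levels below \<open>m\<close> suffice.\<close>
    also have "\<dots> = (\<Sum>n<m. \<Sum>i\<in>{i \<in> ?F. N i = n}. (1/2::real) ^ r i)"
    proof (rule sum.group[symmetric])
      show "N ` ?F \<subseteq> {..<m}"
      proof (rule image_subsetI)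
        fix i assume "i \<in> ?F"
        moreover have "N i \<le> i"
          using le_prod_encode_1[of "N i" "snd (prod_decode i)"] by (simp add: N_def)
        ultimately show "N i \<in> {..<m}" by simp
      qed
    qed auto
    also have "\<dots> \<le> (\<Sum>n<m. (1/2::real) ^ Suc n)"
    proof (rule sum_mono)
      fix n
      let ?I = "{i \<in> ?F. N i = n}"
      have I: "?I = {i \<in> {..<m}. v i \<and> N i = n}" by auto
      have "(\<Sum>i\<in>?I. (1/2::real) ^ r i) = (\<Sum>i\<in>?I. 2 ^ n * (1/2) ^ length (branch_bits P (out i)))"
      proof (rule sum.cong)
        fix i assume "i \<in> ?I"
        then have "length (branch_bits P (out i)) = r i + n"
          using N_le[of i] by (auto simp: r_def)
        then show "(1/2::real) ^ r i = 2 ^ n * (1/2) ^ length (branch_bits P (out i))"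
          by (simp add: power_add power_one_over)
      qed simp
      also have "\<dots> = 2 ^ n * (\<Sum>i\<in>?I. (1/2) ^ length (branch_bits P (out i)))"
        by (simp add: sum_distrib_left)
      also have "\<dots> \<le> 2 ^ n * measure cantor_measure (\<Union>\<rho>\<in>V (2 * n + 1). cylinder \<rho>)"
      proof (intro mult_left_mono sum_disjoint_cylinders_le sets_V UN_least)
        show "disjoint_family_on (\<lambda>i. cylinder (branch_bits P (out i))) ?I"
          unfolding I by (rule disjoint)
        fix i assume "i \<in> ?I"
        then have "minimal (2 * n + 1) (out i)" by (auto simp: v_def)
        then show "cylinder (branch_bits P (out i)) \<subseteq> (\<Union>\<rho>\<in>V (2 * n + 1). cylinder \<rho>)"
          by (rule minimal_subset)
      qed auto
      also have "\<dots> \<le> 2 ^ n * (1/2) ^ (2 * n + 1)" by (intro mult_left_mono measure_V) simp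
      also have "\<dots> = (2 ^ n * (1/2) ^ n) * (1/2) ^ Suc n" by (simp add: mult_2 power_add)
      also have "2 ^ n * (1/2::real) ^ n = 1" by (simp flip: power_mult_distrib)
      finally show "(\<Sum>i\<in>?I. (1/2::real) ^ r i) \<le> (1/2) ^ Suc n" by simp
    qed
    also have "\<dots> = 1 - (1/2) ^ m" by (induction m) simp_all
    also have "\<dots> \<le> 1" by simp
    finally show ?thesis .
  qed
  obtain c where c: "\<And>i. v i \<Longrightarrow> \<exists>\<tau>. U \<tau> = Some (out i) \<and> length \<tau> \<le> r i + c"
    using optimal_machine_requests[OF U comp weight] by blast
  have "\<exists>m. complexity U (X \<restriction>\<^bsub>seq\<^esub> m) + n \<le> length (branch_bits P (X \<restriction>\<^bsub>seq\<^esub> m)) + c" for n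
  proof -
    obtain \<rho> where \<rho>: "\<rho> \<in> V (2 * n + 1)" "R \<in> cylinder \<rho>" using RV by blast
    then obtain s where s: "p ((2 * n + 1, \<rho>), s)" using p_iff by blast
    \<comment> \<open>By stage \<open>s\<close> the string \<open>\<rho>\<close> has been
      enumerated, and at length \<open>l\<close> the branching bits are long enough to contain it;
      length \<open>max s l\<close> meets both demands.\<close>
    obtain l where l: "length \<rho> \<le> length (branch_bits P (X \<restriction>\<^bsub>seq\<^esub> l))" using unbounded by blast
    let ?\<sigma> = "X \<restriction>\<^bsub>seq\<^esub> max s l"
    have "prefix (X \<restriction>\<^bsub>seq\<^esub> l) ?\<sigma>" by (metis max.cobounded2 take_initseg take_is_prefix)
    from prefix_length_le[OF branch_bits_mono[OF this, of P]] l
    have len: "length \<rho> \<le> length (branch_bits P ?\<sigma>)" by simp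
    with \<rho>(2) R[of "max s l"] have "take (length \<rho>) (branch_bits P ?\<sigma>) = \<rho>"
      by (auto simp: cylinder_iff list_eq_iff_nth_eq)
    with s len p_mono[OF s, of "max s l"] have "covered (2 * n + 1) ?\<sigma>"
      unfolding covered_def by (intro exI[of _ "length \<rho>"]) simp
    then have ex: "\<exists>m. covered (2 * n + 1) (X \<restriction>\<^bsub>seq\<^esub> m)" by blast
    \<comment> \<open>The shortest covered initial segment of \<open>X\<close> is minimal at this
      level.\<close>
    define m where "m = (LEAST m. covered (2 * n + 1) (X \<restriction>\<^bsub>seq\<^esub> m))"
    have cov: "covered (2 * n + 1) (X \<restriction>\<^bsub>seq\<^esub> m)" unfolding m_def by (rule LeastI_ex[OF ex])
    have "\<not> covered (2 * n + 1) (butlast (X \<restriction>\<^bsub>seq\<^esub> m))" if ne: "X \<restriction>\<^bsub>seq\<^esub> m \<noteq> []"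
    proof -
      obtain m' where m': "m = Suc m'" using ne by (cases m) (auto simp: initseg_def)
      then have "\<not> covered (2 * n + 1) (X \<restriction>\<^bsub>seq\<^esub> m')"
        using not_less_Least[of m' "\<lambda>m. covered (2 * n + 1) (X \<restriction>\<^bsub>seq\<^esub> m)", folded m_def] by simp
      then show ?thesis by (simp add: m' initseg_Suc)
    qed
    then have min: "minimal (2 * n + 1) (X \<restriction>\<^bsub>seq\<^esub> m)"
      using cov initseg_extendible[OF X] by (auto simp: minimal_def)
    define i where "i = prod_encode (n, enc (X \<restriction>\<^bsub>seq\<^esub> m))"
    have i: "N i = n" "out i = X \<restriction>\<^bsub>seq\<^esub> m" by (simp_all add: i_def N_def out_def)
    have "v i" using min initseg_extendible[OF X, of m]
      by (simp add: v_def i) (simp add: i_def tree_oracle_def str_code_eq_enc)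
    from c[OF this] obtain \<tau> where \<tau>: "U \<tau> = Some (X \<restriction>\<^bsub>seq\<^esub> m)" "length \<tau> \<le> r i + c"
      unfolding i by blast
    have "complexity U (X \<restriction>\<^bsub>seq\<^esub> m) + n \<le> r i + c + n"
      using complexity_le[of U \<tau> "X \<restriction>\<^bsub>seq\<^esub> m"] \<tau> by simp
    also have "\<dots> = length (branch_bits P (X \<restriction>\<^bsub>seq\<^esub> m)) + c"
      using N_le[OF \<open>v i\<close>] by (simp add: r_def i)
    finally show ?thesis by blast
  qed
  then show ?thesis by blast
qed

section \<open>Equivalence of random production and incompressibility along the path\<close>

theorem theorem3p4:
  fixes P :: "(nat \<Rightarrow> bool) set"
    and U :: "bool list \<Rightarrow> bool list option"
    and X :: "nat \<Rightarrow> bool"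
  assumes "Pi01_class P" and "P \<noteq> {}"
    and "optimal_machine (tree_oracle P) U"
    and "X \<in> P"
  shows "X \<in> randomly_produced_paths P \<longleftrightarrow>
    (\<exists>c::int. \<forall>n. int (complexity U (X \<restriction>\<^bsub>seq\<^esub> n)) \<ge> int (theta P (X \<restriction>\<^bsub>seq\<^esub> n)) - c)"
proof -
  let ?A = "tree_oracle P"
  let ?b = "\<lambda>n. branch_bits P (X \<restriction>\<^bsub>seq\<^esub> n)"
  have theta: "theta P (X \<restriction>\<^bsub>seq\<^esub> n) = length (?b n)" for n
    by (rule theta_eq_length_branch_bits[OF initseg_extendible[OF assms(4)]])
  have b_mono: "prefix (?b m) (?b n)" if "m \<le> n" for m n
    by (rule branch_bits_mono) (metis that take_initseg take_is_prefix)
  show ?thesis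
    unfolding randomly_produced_iff[OF assms(4)] theta
  proof
    assume "\<exists>R\<in>MLR ?A. \<forall>n. R \<in> cylinder (?b n)"
    then obtain R where R: "R \<in> MLR ?A" "\<And>n. R \<in> cylinder (?b n)" by blast
    show "\<exists>c::int. \<forall>n. int (complexity U (X \<restriction>\<^bsub>seq\<^esub> n)) \<ge> int (length (?b n)) - c"
    proof (rule ccontr)
      assume contra: "\<not> ?thesis"
      let ?V = "\<lambda>c. {branch_bits P \<sigma> | \<sigma> \<tau>. U \<tau> = Some \<sigma> \<and> \<sigma> \<in> extendible P \<and>
        length \<tau> + c \<le> length (branch_bits P \<sigma>)}"
      have "R \<in> (\<Union>\<rho>\<in>?V c. cylinder \<rho>)" for c
      proof -
        obtain n where n: "int (complexity U (X \<restriction>\<^bsub>seq\<^esub> n)) < int (length (?b n)) - int c"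
          using contra by (meson not_le)
        obtain \<tau> where "U \<tau> = Some (X \<restriction>\<^bsub>seq\<^esub> n)" "length \<tau> = complexity U (X \<restriction>\<^bsub>seq\<^esub> n)"
          by (rule optimal_machine_complexity_attained[OF assms(3)])
        with n initseg_extendible[OF assms(4)] have "?b n \<in> ?V c" by force
        with R(2) show ?thesis by blast
      qed
      moreover have "MartinLoef_test ?A ?V"
        using assms(3) unfolding optimal_machine_def by (intro compressed_branch_bits_test) blast
      ultimately show False using R(1) unfolding MLR_def by blast
    qed
  next
    assume "\<exists>c::int. \<forall>n. int (complexity U (X \<restriction>\<^bsub>seq\<^esub> n)) \<ge> int (length (?b n)) - c"
    then obtain c :: int where c: "\<And>n. int (complexity U (X \<restriction>\<^bsub>seq\<^esub> n)) \<ge> int (length (?b n)) - c" by blast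
    show "\<exists>R\<in>MLR ?A. \<forall>n. R \<in> cylinder (?b n)"
    proof (cases "\<exists>l. \<forall>n. length (?b n) \<le> l")
      case True
      \<comment> \<open>With finitely many branchings along \<open>X\<close> the recorded bits
        stabilise at \<open>?b n0\<close>, and any random member of that cylinder is a source of
        \<open>X\<close>.\<close>
      then obtain n0 where n0: "\<And>n. length (?b n) \<le> length (?b n0)"
        using ex_has_greatest_nat[of "\<lambda>_. True" 0 "\<lambda>n. length (?b n)"] by (metis le_imp_less_Suc)
      have "prefix (?b n) (?b n0)" for n
      proof (cases "n \<le> n0")
        case False
        then have "prefix (?b n0) (?b n)" by (intro b_mono) simp
        moreover have "length (?b n) \<le> length (?b n0)" by (rule n0)
        ultimately show ?thesis by (auto simp: prefix_def)
      qed (rule b_mono)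
      moreover obtain R where "R \<in> MLR ?A" "R \<in> cylinder (?b n0)" using MLR_meets_cylinder by blast
      ultimately show ?thesis using cylinder_mono by blast
    next
      case False
      then have unbounded: "\<exists>n. l \<le> length (?b n)" for l by (meson nat_le_linear)
      \<comment> \<open>The strings \<open>?b n\<close> form a chain of unbounded length and so have
        one common extension; its bit at \<open>k\<close> can be read off any of them that is long
        enough.\<close>
      define R where "R k = ?b (SOME n. k < length (?b n)) ! k" for k
      have R: "R \<in> cylinder (?b n)" for n
        unfolding cylinder_iff
      proof (intro allI impI)
        fix k assume k: "k < length (?b n)"
        define n' where "n' = (SOME n. k < length (?b n))"
        have k': "k < length (?b n')" unfolding n'_def by (rule someI[of "\<lambda>n. k < length (?b n)", OF k])
        have "?b n' ! k = ?b n ! k"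
          using b_mono[of n n'] b_mono[of n' n] k k' by (cases "n \<le> n'") (auto simp: prefix_def nth_append)
        then show "R k = ?b n ! k" by (simp add: R_def n'_def)
      qed
      moreover have "R \<in> MLR ?A"
      proof (rule ccontr)
        assume "R \<notin> MLR ?A"
        then obtain d where d: "\<And>n. \<exists>m. complexity U (X \<restriction>\<^bsub>seq\<^esub> m) + n \<le> length (?b m) + d"
          using compressible_if_not_random[OF assms(3,4) R unbounded] by blast
        \<comment> \<open>The saving exceeds \<open>d + nat c\<close> by one, just enough to violate
          the assumed lower bound; \<open>nat c\<close> also covers a negative
          \<open>c\<close>.\<close>
        obtain m where "complexity U (X \<restriction>\<^bsub>seq\<^esub> m) + Suc (d + nat c) \<le> length (?b m) + d"
          using d by blast
        with c[of m] show False by linarith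
      qed
      ultimately show ?thesis by blast
    qed
  qed
qed

end
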